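(* Let $G$ be any torsion-free nilpotent group. (a) The Identity Problem and the Left-Order Extension Problem are complements for $G$: a finite subset $S$ of $G$ extends to a left-order on $G$ if and only if $e_G\notin S^+$. (b) The Normal Identity Problem and the Bi-Order Extension Problem are complements for $G$: a finite subset $S$ of $G$ extends to a bi-order on $G$ if and only if $e_G\notin S^\circ$.
   Context: Let $e_G$ be the identity of $G$. A left-order on $G$ is a total order $\le$ with $a\le b\Rightarrow ca\le cb$ for all $a,b,c\in G$; a bi-order is a total order with $a\le b\Rightarrow cad\le cbd$ for all $a,b,c,d\in G$. A subset $S$ of $G$ extends to such an order if $S$ is contained in its positive cone $\{a\in G\mid e_G<a\}$. For $S\subseteq G$, $S^+$ is the subsemigroup generated by $S$, and $S^\circ$ is the normal subsemigroup generated by $S$ (the smallest subsemigroup containing $S$ and closed under conjugation by elements of $G$); both are empty if $S=\emptyset$. The Identity Problem (Normal Identity Problem) asks, for a given finite $S\subseteq G$, whether $e_G\in S^+$ ($e_G\in S^\circ$). The Left-Order (Bi-Order) Extension Problem asks whether a given finite $S\subseteq G$ extends to a left-order (bi-order) on $G$. *)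

theory Defs
  imports "HOL-Algebra.Algebra"
begin

definition torsion_free :: "('a, 'b) monoid_scheme \<Rightarrow> bool"
  where "torsion_free G \<longleftrightarrow>
    (\<forall>x \<in> carrier G. \<forall>n::nat. n > 0 \<longrightarrow> x [^]\<^bsub>G\<^esub> n = \<one>\<^bsub>G\<^esub> \<longrightarrow> x = \<one>\<^bsub>G\<^esub>)"

text \<open>The lower central series, indexed from 0 so that the term with index 0 is the whole group.
  The commutator convention is that of \<^const>\<open>derived\<close>.\<close>

primrec lower_central :: "('a, 'b) monoid_scheme \<Rightarrow> nat \<Rightarrow> 'a set"
  where
    "lower_central G 0 = carrier G"
  | "lower_central G (Suc n) =
      generate G (\<Union>x \<in> lower_central G n. \<Union>y \<in> carrier G.
        {x \<otimes>\<^bsub>G\<^esub> y \<otimes>\<^bsub>G\<^esub> inv\<^bsub>G\<^esub> x \<otimes>\<^bsub>G\<^esub> inv\<^bsub>G\<^esub> y})"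

definition nilpotent_group :: "('a, 'b) monoid_scheme \<Rightarrow> bool"
  where "nilpotent_group G \<longleftrightarrow> group G \<and> (\<exists>n. lower_central G n = {\<one>\<^bsub>G\<^esub>})"

definition left_order :: "('a, 'b) monoid_scheme \<Rightarrow> 'a rel \<Rightarrow> bool"
  where "left_order G r \<longleftrightarrow> linear_order_on (carrier G) r \<and>
    (\<forall>a \<in> carrier G. \<forall>b \<in> carrier G. \<forall>c \<in> carrier G.
      (a, b) \<in> r \<longrightarrow> (c \<otimes>\<^bsub>G\<^esub> a, c \<otimes>\<^bsub>G\<^esub> b) \<in> r)"

definition bi_order :: "('a, 'b) monoid_scheme \<Rightarrow> 'a rel \<Rightarrow> bool"
  where "bi_order G r \<longleftrightarrow> linear_order_on (carrier G) r \<and>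
    (\<forall>a \<in> carrier G. \<forall>b \<in> carrier G. \<forall>c \<in> carrier G. \<forall>d \<in> carrier G.
      (a, b) \<in> r \<longrightarrow> (c \<otimes>\<^bsub>G\<^esub> a \<otimes>\<^bsub>G\<^esub> d, c \<otimes>\<^bsub>G\<^esub> b \<otimes>\<^bsub>G\<^esub> d) \<in> r)"

definition positive_cone :: "('a, 'b) monoid_scheme \<Rightarrow> 'a rel \<Rightarrow> 'a set"
  where "positive_cone G r = {a \<in> carrier G. (\<one>\<^bsub>G\<^esub>, a) \<in> r \<and> a \<noteq> \<one>\<^bsub>G\<^esub>}"

definition extends_to_left_order :: "('a, 'b) monoid_scheme \<Rightarrow> 'a set \<Rightarrow> bool"
  where "extends_to_left_order G S \<longleftrightarrow> (\<exists>r. left_order G r \<and> S \<subseteq> positive_cone G r)"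

definition extends_to_bi_order :: "('a, 'b) monoid_scheme \<Rightarrow> 'a set \<Rightarrow> bool"
  where "extends_to_bi_order G S \<longleftrightarrow> (\<exists>r. bi_order G r \<and> S \<subseteq> positive_cone G r)"

inductive_set subsemigroup_gen :: "('a, 'b) monoid_scheme \<Rightarrow> 'a set \<Rightarrow> 'a set"
  for G and S
  where
    incl: "s \<in> S \<Longrightarrow> s \<in> subsemigroup_gen G S"
  | mult: "x \<in> subsemigroup_gen G S \<Longrightarrow> y \<in> subsemigroup_gen G S \<Longrightarrow>
      x \<otimes>\<^bsub>G\<^esub> y \<in> subsemigroup_gen G S"

inductive_set normal_subsemigroup_gen :: "('a, 'b) monoid_scheme \<Rightarrow> 'a set \<Rightarrow> 'a set"
  for G and S
  where
    incl: "s \<in> S \<Longrightarrow> s \<in> normal_subsemigroup_gen G S"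
  | mult: "x \<in> normal_subsemigroup_gen G S \<Longrightarrow> y \<in> normal_subsemigroup_gen G S \<Longrightarrow>
      x \<otimes>\<^bsub>G\<^esub> y \<in> normal_subsemigroup_gen G S"
  | conj: "x \<in> normal_subsemigroup_gen G S \<Longrightarrow> g \<in> carrier G \<Longrightarrow>
      g \<otimes>\<^bsub>G\<^esub> x \<otimes>\<^bsub>G\<^esub> inv\<^bsub>G\<^esub> g \<in> normal_subsemigroup_gen G S"

text \<open>A decision problem for a fixed group is represented by its set of yes-instances, the set of
  all instances being the set of finite subsets of the group. Two problems are complements if
  every instance is a yes-instance of exactly one of them.\<close>

definition instances :: "('a, 'b) monoid_scheme \<Rightarrow> 'a set set"
  where "instances G = {S. finite S \<and> S \<subseteq> carrier G}"

definition identity_problem :: "('a, 'b) monoid_scheme \<Rightarrow> 'a set set"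
  where "identity_problem G = {S \<in> instances G. \<one>\<^bsub>G\<^esub> \<in> subsemigroup_gen G S}"

definition normal_identity_problem :: "('a, 'b) monoid_scheme \<Rightarrow> 'a set set"
  where "normal_identity_problem G = {S \<in> instances G. \<one>\<^bsub>G\<^esub> \<in> normal_subsemigroup_gen G S}"

definition left_order_extension_problem :: "('a, 'b) monoid_scheme \<Rightarrow> 'a set set"
  where "left_order_extension_problem G = {S \<in> instances G. extends_to_left_order G S}"

definition bi_order_extension_problem :: "('a, 'b) monoid_scheme \<Rightarrow> 'a set set"
  where "bi_order_extension_problem G = {S \<in> instances G. extends_to_bi_order G S}"

definition complementary_problems ::
    "('a, 'b) monoid_scheme \<Rightarrow> 'a set set \<Rightarrow> 'a set set \<Rightarrow> bool"
  where "complementary_problems G P Q \<longleftrightarrow> P \<union> Q = instances G \<and> P \<inter> Q = {}"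

end

theory Submission
  imports Defs
begin

text \<open>By Zorn's lemma it suffices that a subsemigroup \<open>P\<close> without \<open>\<one>\<close> (closed under conjugation in the
  case of bi-orders) can be enlarged by \<open>x\<close> or by \<open>inv x\<close> whenever \<open>x \<noteq> \<one>\<close>. Suppose that neither is
  possible. The two words that witness this involve finitely many elements, so one may pass to a finitely
  generated subgroup. Put \<open>M = P \<union> {\<one>}\<close> and let \<open>H\<^sub>0\<close> be the normal subgroup generated by \<open>x\<close> and the
  letters from \<open>P\<close>, with \<open>H\<^sub>i\<^sub>+\<^sub>1 = [H\<^sub>i, G]\<close>. In the abelian group \<open>H\<^sub>0 / H\<^sub>1\<close> the words show that every
  element has a positive power in the image of \<open>M\<close>. This property lifts from \<open>H\<^sub>0 / H\<^sub>i\<close> to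
  \<open>H\<^sub>0 / H\<^sub>i\<^sub>+\<^sub>1\<close>: commutators of \<open>k\<close>-th powers are quadratic in \<open>k\<close>, while the central error made by
  replacing inverses by elements of \<open>M\<close> is only linear in \<open>k\<close>. At the end of the series, positive powers
  of \<open>x\<close> and of \<open>inv x\<close> lie in \<open>M\<close>, and so \<open>x\<close> is a torsion element.\<close>

section \<open>Submonoids modulo a central subgroup\<close>

text \<open>A central commutator is bilinear: moving one \<open>y\<close> past one \<open>g\<close>
  costs one factor \<open>c\<close>, so moving \<open>n\<close> copies past \<open>k\<close> copies
  costs \<open>n * k\<close> of them.\<close>

lemma (in group) pow_mult_pow_central:
  assumes "c \<in> carrier G" "y \<in> carrier G" "g \<in> carrier G"
    and central: "\<And>u. u \<in> carrier G \<Longrightarrow> c \<otimes> u = u \<otimes> c"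
    and comm: "y \<otimes> g = c \<otimes> (g \<otimes> y)"
  shows "y [^] (n::nat) \<otimes> g [^] (k::nat) = c [^] (n * k) \<otimes> (g [^] k \<otimes> y [^] n)"
proof -
  have cpow: "c [^] (m::nat) \<otimes> u = u \<otimes> c [^] m" if "u \<in> carrier G" for m u
    using that assms(1) central by (induction m) (simp_all add: m_assoc, metis m_assoc nat_pow_closed)
  have 1: "y \<otimes> g [^] (k::nat) = c [^] k \<otimes> (g [^] k \<otimes> y)" for k
  proof (induction k)
    case 0 then show ?case using assms by simp
  next
    case (Suc k)
    have "y \<otimes> g [^] Suc k = (y \<otimes> g [^] k) \<otimes> g" using assms by (simp add: m_assoc)
    also have "\<dots> = c [^] k \<otimes> (g [^] k \<otimes> (y \<otimes> g))" using assms Suc by (simp add: m_assoc)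
    also have "\<dots> = c [^] k \<otimes> ((g [^] k \<otimes> c) \<otimes> (g \<otimes> y))"
      unfolding comm using assms(1-3) by (simp add: m_assoc)
    also have "\<dots> = c [^] Suc k \<otimes> (g [^] Suc k \<otimes> y)"
      using assms(1-3) central[of "g [^] k", symmetric] by (simp add: m_assoc)
    finally show ?case .
  qed
  show ?thesis
  proof (induction n)
    case 0 then show ?case using assms by simp
  next
    case (Suc n)
    have "y [^] Suc n \<otimes> g [^] k = y [^] n \<otimes> (y \<otimes> g [^] k)" using assms by (simp add: m_assoc)
    also have "\<dots> = y [^] n \<otimes> (c [^] k \<otimes> (g [^] k \<otimes> y))" by (simp add: 1)
    also have "\<dots> = c [^] k \<otimes> ((y [^] n \<otimes> g [^] k) \<otimes> y)"
      using assms(1-3) cpow[of "y [^] n" k, symmetric] by (simp add: m_assoc flip: m_assoc[of "y [^] n" "c [^] k"])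
    also have "\<dots> = c [^] (Suc n * k) \<otimes> (g [^] k \<otimes> y [^] Suc n)"
      using assms(1-3) by (simp add: Suc m_assoc flip: nat_pow_mult)
    finally show ?case .
  qed
qed

text \<open>One step of the descent takes place here: the group will be the quotient by one term of
  the series, \<open>A\<close> the image of the preceding term, and \<open>M\<close> the image of
  the cone with \<open>\<one>\<close> adjoined.\<close>

locale submonoid_and_central_subgroup = group G for G (structure) +
  fixes M A :: "'a set"
  assumes M_carrier: "M \<subseteq> carrier G"
    and M_one: "\<one> \<in> M"
    and M_mult: "\<lbrakk>u \<in> M; v \<in> M\<rbrakk> \<Longrightarrow> u \<otimes> v \<in> M"
    and A_subgroup: "subgroup A G"
    and A_central: "\<lbrakk>a \<in> A; u \<in> carrier G\<rbrakk> \<Longrightarrow> a \<otimes> u = u \<otimes> a"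
begin

lemma A_closed [simp]: "a \<in> A \<Longrightarrow> a \<in> carrier G"
  using A_subgroup by (rule subgroup.mem_carrier)

lemma M_closed [simp]: "u \<in> M \<Longrightarrow> u \<in> carrier G"
  using M_carrier by blast

lemma A_one: "\<one> \<in> A"
  and A_mult: "\<lbrakk>a \<in> A; b \<in> A\<rbrakk> \<Longrightarrow> a \<otimes> b \<in> A"
  and A_inv: "a \<in> A \<Longrightarrow> inv a \<in> A"
  using A_subgroup by (auto intro: subgroup.one_closed subgroup.m_closed subgroup.m_inv_closed)

lemma M_pow: "u \<in> M \<Longrightarrow> u [^] (n::nat) \<in> M"
  by (induction n) (auto intro: M_one M_mult)

lemma A_pow: "a \<in> A \<Longrightarrow> a [^] (n::nat) \<in> A"
  by (induction n) (auto intro: A_one A_mult)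

lemma mult_exchange:
  assumes "u \<in> carrier G" "v \<in> carrier G" "a \<in> A" "b \<in> carrier G"
  shows "(u \<otimes> a) \<otimes> (v \<otimes> b) = (u \<otimes> v) \<otimes> (a \<otimes> b)"
proof -
  have "a \<otimes> (v \<otimes> b) = v \<otimes> (a \<otimes> b)"
    using assms A_central[of a v] by (metis A_closed m_assoc)
  then show ?thesis using assms by (simp add: m_assoc)
qed

lemma pow_mult_A:
  assumes "u \<in> carrier G" "a \<in> A"
  shows "(u \<otimes> a) [^] (n::nat) = u [^] n \<otimes> a [^] n"
  using assms A_central[of a u] by (intro pow_mult_distrib) auto

text \<open>In additive notation, \<open>n k\<^sup>2 c + e k z \<in> M\<close> for all \<open>k\<close>: the linear error term in \<open>z\<close> is
  dominated by the quadratic term as soon as \<open>- z\<close> is one of the \<open>c\<close>.\<close>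

definition absorbed :: "'a \<Rightarrow> 'a set"
  where "absorbed z = {c \<in> A. \<exists>n>0. \<exists>e. \<forall>k::nat. c [^] (n * k\<^sup>2) \<otimes> z [^] (e * k) \<in> M}"

lemma absorbedI:
  assumes "c \<in> A" "n > 0" "\<And>k::nat. c [^] (n * k\<^sup>2) \<otimes> z [^] (e * k) \<in> M"
  shows "c \<in> absorbed z"
  using assms unfolding absorbed_def by blast

lemma absorbed_mono:
  assumes "z \<in> M \<inter> A" "w \<in> M \<inter> A"
  shows "absorbed z \<subseteq> absorbed (z \<otimes> w)"
proof
  fix c assume "c \<in> absorbed z"
  then obtain n e where c: "c \<in> A" "n > 0"
    and k: "c [^] (n * k\<^sup>2) \<otimes> z [^] (e * k) \<in> M" for k :: nat
    unfolding absorbed_def by blast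
  have "c [^] (n * k\<^sup>2) \<otimes> (z \<otimes> w) [^] (e * k) \<in> M" for k :: nat
  proof -
    have "c [^] (n * k\<^sup>2) \<otimes> (z \<otimes> w) [^] (e * k) = (c [^] (n * k\<^sup>2) \<otimes> z [^] (e * k)) \<otimes> w [^] (e * k)"
      using assms c by (simp add: pow_mult_A m_assoc)
    then show ?thesis using k[of k] M_pow[of w "e * k"] assms by (simp add: M_mult)
  qed
  with c show "c \<in> absorbed (z \<otimes> w)" by (blast intro: absorbedI)
qed

lemma absorbed_one: "\<one> \<in> absorbed z" if "z \<in> M"
  by (rule absorbedI[of _ 1 _ 0]) (simp_all add: A_one M_one)

text \<open>Raising the first membership to the power \<open>m\<close> and the second to the power
  \<open>n\<close> equalizes the quadratic coefficients; centrality of \<open>A\<close> then merges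
  the two products.\<close>

lemma absorbed_mult:
  assumes z: "z \<in> M \<inter> A" and "c \<in> absorbed z" "d \<in> absorbed z"
  shows "c \<otimes> d \<in> absorbed z"
proof -
  obtain n e where c: "c \<in> A" "n > 0"
    and kc: "\<And>k::nat. c [^] (n * k\<^sup>2) \<otimes> z [^] (e * k) \<in> M"
    using assms unfolding absorbed_def by blast
  obtain m f where d: "d \<in> A" "m > 0"
    and kd: "\<And>k::nat. d [^] (m * k\<^sup>2) \<otimes> z [^] (f * k) \<in> M"
    using assms unfolding absorbed_def by blast
  have "(c \<otimes> d) [^] (n * m * k\<^sup>2) \<otimes> z [^] ((e * m + f * n) * k) \<in> M" for k :: nat
  proof -
    have "(c \<otimes> d) [^] (n * m * k\<^sup>2) \<otimes> z [^] ((e * m + f * n) * k)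
        = (c [^] (n * k\<^sup>2 * m) \<otimes> d [^] (m * k\<^sup>2 * n)) \<otimes> (z [^] (e * k * m) \<otimes> z [^] (f * k * n))"
      using c d z by (simp add: pow_mult_A nat_pow_mult algebra_simps)
    also have "\<dots> = (c [^] (n * k\<^sup>2 * m) \<otimes> z [^] (e * k * m)) \<otimes> (d [^] (m * k\<^sup>2 * n) \<otimes> z [^] (f * k * n))"
      using c d z A_pow by (subst mult_exchange) auto
    also have "\<dots> = (c [^] (n * k\<^sup>2) \<otimes> z [^] (e * k)) [^] m \<otimes> (d [^] (m * k\<^sup>2) \<otimes> z [^] (f * k)) [^] n"
      using c d z A_pow by (simp add: pow_mult_A nat_pow_pow)
    also have "\<dots> \<in> M" by (intro M_mult M_pow kc kd)
    finally show ?thesis .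
  qed
  then show ?thesis using c d by (intro absorbedI[of _ "n * m"]) (auto intro: A_mult)
qed

text \<open>By \<open>absorbed_mono\<close>, the product of two absorbing elements absorbs whatever
  either of them absorbs.\<close>

lemma common_absorbing_element:
  assumes "finite C" "\<And>c. c \<in> C \<Longrightarrow> \<exists>z \<in> M \<inter> A. c \<in> absorbed z"
  shows "\<exists>z \<in> M \<inter> A. C \<subseteq> absorbed z"
  using assms
proof (induction C rule: finite_induct)
  case empty then show ?case using M_one A_one by blast
next
  case (insert c C)
  then obtain z w where z: "z \<in> M \<inter> A" "C \<subseteq> absorbed z" and w: "w \<in> M \<inter> A" "c \<in> absorbed w"
    by (metis insertCI)
  have "w \<otimes> z = z \<otimes> w" using A_central z w by auto
  then have "insert c C \<subseteq> absorbed (z \<otimes> w)"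
    using absorbed_mono[OF z(1) w(1)] absorbed_mono[OF w(1) z(1)] z w by auto
  moreover have "z \<otimes> w \<in> M \<inter> A" using z w M_mult A_mult by auto
  ultimately show ?case by blast
qed

text \<open>A common \<open>z\<close> for all generators and their inverses absorbs all of
  \<open>A\<close>, in particular \<open>inv z\<close>. This puts a positive power of
  \<open>inv z\<close> into \<open>M\<close>, which cancels the error term of any other
  \<open>a\<close>.\<close>

lemma power_in_submonoid_of_absorbed_generators:
  assumes fin: "finite C" and gen: "generate G C = A"
    and abs: "\<And>c. c \<in> C \<Longrightarrow> \<exists>z \<in> M \<inter> A. c \<in> absorbed z"
    and abs_inv: "\<And>c. c \<in> C \<Longrightarrow> \<exists>z \<in> M \<inter> A. inv c \<in> absorbed z"
    and a: "a \<in> A"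
  shows "\<exists>n::nat. n > 0 \<and> a [^] n \<in> M"
proof -
  obtain z where z: "z \<in> M \<inter> A" and sub: "C \<union> m_inv G ` C \<subseteq> absorbed z"
    using common_absorbing_element[of "C \<union> m_inv G ` C"] fin abs abs_inv by blast
  have all: "b \<in> absorbed z" if "b \<in> A" for b
  proof -
    have "b \<in> generate G C" using that gen by simp
    then show ?thesis
      by (induction rule: generate.induct) (use sub z absorbed_one absorbed_mult in auto)
  qed
  obtain n e where n: "n > 0" and k: "\<And>k::nat. inv z [^] (n * k\<^sup>2) \<otimes> z [^] (e * k) \<in> M"
    using all[OF A_inv[of z]] z unfolding absorbed_def by blast
  \<comment> \<open>At \<open>k = e + 1\<close> the quadratic exponent exceeds the linear one, and
    \<open>s\<close> is the surplus of factors \<open>inv z\<close>.\<close>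
  define s where "s = n * (e + 1)\<^sup>2 - e * (e + 1)"
  have less: "e * (e + 1) < n * (e + 1)\<^sup>2"
  proof -
    have "e * (e + 1) < (e + 1) * (e + 1)" by simp
    also have "\<dots> \<le> n * ((e + 1) * (e + 1))" using n by (cases n) auto
    finally show ?thesis by (simp add: power2_eq_square)
  qed
  then have s: "s > 0" and split: "n * (e + 1)\<^sup>2 = s + e * (e + 1)" by (simp_all add: s_def)
  have "inv z [^] (n * (e + 1)\<^sup>2) \<otimes> z [^] (e * (e + 1)) = inv z [^] s"
    using z unfolding split by (simp add: m_assoc nat_pow_inv nat_pow_mult[symmetric] del: mult_Suc_right)
  with k[of "e + 1"] have zs: "inv z [^] s \<in> M" by simp
  obtain m f where m: "m > 0" and km: "\<And>k::nat. a [^] (m * k\<^sup>2) \<otimes> z [^] (f * k) \<in> M"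
    using all[OF a] unfolding absorbed_def by blast
  \<comment> \<open>For \<open>k = 1\<close> the error is \<open>z [^] f\<close>; after raising to
    the power \<open>s\<close> it is cancelled by \<open>f\<close> copies of
    \<open>inv z [^] s\<close>.\<close>
  have "(a [^] m \<otimes> z [^] f) [^] s \<otimes> (inv z [^] s) [^] f \<in> M"
    using km[of 1] zs by (simp add: M_mult M_pow)
  also have "(a [^] m \<otimes> z [^] f) [^] s \<otimes> (inv z [^] s) [^] f
      = a [^] (m * s) \<otimes> (z [^] (s * f) \<otimes> inv z [^] (s * f))"
    using a z A_pow by (simp add: pow_mult_A nat_pow_pow m_assoc mult.commute)
  also have "\<dots> = a [^] (m * s)" using a z by (simp add: nat_pow_inv)
  finally show ?thesis using m s by (intro exI[of _ "m * s"]) simp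
qed


section \<open>Absorption of central commutators of elements with a power in \<open>M\<close> modulo
  \<open>A\<close>\<close>

definition power_split :: "'a set"
  where "power_split = {h \<in> carrier G. \<exists>n::nat. n > 0 \<and> (\<exists>m \<in> M. \<exists>a \<in> A. h [^] n = m \<otimes> a)}"

text \<open>Exponents can be multiplied together because central factors split off from powers. The
  correction \<open>a\<close> stands next to \<open>h [^] n\<close>, so that their product is an
  element of \<open>M\<close> to calculate with.\<close>

lemma power_split_common_exponent:
  assumes "finite F" "F \<subseteq> power_split"
  shows "\<exists>n::nat. n > 0 \<and> (\<forall>h \<in> F. \<exists>a \<in> A. h [^] n \<otimes> a \<in> M)"
  using assms
proof (induction F rule: finite_induct)
  case empty then show ?case by auto
next
  case (insert h F)
  then obtain n where n: "n > 0" "\<And>h. h \<in> F \<Longrightarrow> \<exists>a \<in> A. h [^] (n::nat) \<otimes> a \<in> M" by auto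
  obtain k m a where k: "k > 0" "m \<in> M" "a \<in> A" "h [^] (k::nat) = m \<otimes> a" and h: "h \<in> carrier G"
    using insert.prems unfolding power_split_def by auto
  have "\<exists>a \<in> A. f [^] (k * n) \<otimes> a \<in> M" if f_in: "f \<in> insert h F" for f
  proof (cases "f = h")
    case True
    have "h [^] (k * n) \<otimes> inv (a [^] n) = m [^] n"
      using k h by (simp add: pow_mult_A m_assoc flip: nat_pow_pow)
    then show ?thesis using True k by (metis A_inv A_pow M_pow)
  next
    case False
    then obtain b where b: "b \<in> A" "f [^] n \<otimes> b \<in> M" using n(2)[of f] f_in by auto
    have f: "f \<in> carrier G" using f_in insert.prems by (auto simp: power_split_def)
    have "f [^] (k * n) \<otimes> b [^] k = (f [^] n \<otimes> b) [^] k"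
      using f b by (simp add: pow_mult_A nat_pow_pow mult.commute)
    then show ?thesis using b by (metis A_pow M_pow)
  qed
  then show ?case using k n by (intro exI[of _ "k * n"]) simp
qed

text \<open>For \<open>w = g [^] k\<close>, the product of \<open>y [^] n\<close> and the conjugate
  of \<open>inv y [^] n\<close> by \<open>w\<close> is \<open>c [^] (n * k)\<close>. Conjugation
  fixes the central corrections, so the error \<open>a \<otimes> b\<close> does not depend on
  \<open>k\<close>.\<close>

lemma commutator_absorbed_if_conjugation_closed:
  assumes conj: "\<And>g m. g \<in> carrier G \<Longrightarrow> m \<in> M \<Longrightarrow> g \<otimes> m \<otimes> inv g \<in> M"
    and y: "y \<in> power_split" "inv y \<in> power_split" and g: "g \<in> carrier G"
    and c: "c = y \<otimes> g \<otimes> inv y \<otimes> inv g" "c \<in> A"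
  shows "\<exists>z \<in> M \<inter> A. c \<in> absorbed z"
proof -
  have yG: "y \<in> carrier G" using y by (simp add: power_split_def)
  obtain n :: nat where n: "n > 0" "\<forall>h \<in> {y, inv y}. \<exists>a \<in> A. h [^] n \<otimes> a \<in> M"
    using power_split_common_exponent[of "{y, inv y}"] y by auto
  then obtain a b where a: "a \<in> A" "y [^] n \<otimes> a \<in> M" and b: "b \<in> A" "inv y [^] n \<otimes> b \<in> M"
    by auto
  \<comment> \<open>Without the conjugation the powers of \<open>y\<close> cancel, which shows that
    the error itself lies in \<open>M\<close>.\<close>
  have "(y [^] n \<otimes> a) \<otimes> (inv y [^] n \<otimes> b) = a \<otimes> b"
    using yG a b by (subst mult_exchange) (auto simp: nat_pow_inv)
  with a b have z: "a \<otimes> b \<in> M \<inter> A" by (metis A_mult IntI M_mult)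
  have comm: "y \<otimes> g = c \<otimes> (g \<otimes> y)" using yG g by (simp add: c m_assoc flip: m_assoc[of "inv g" g y])
  have base: "c [^] (n * k) \<otimes> (a \<otimes> b) \<in> M" for k :: nat
  proof -
    define w where "w = g [^] k"
    have w: "w \<in> carrier G" using g by (simp add: w_def)
    have "y [^] n \<otimes> w = c [^] (n * k) \<otimes> (w \<otimes> y [^] n)"
      unfolding w_def by (rule pow_mult_pow_central) (use yG g c A_central comm in auto)
    then have "y [^] n \<otimes> (w \<otimes> inv y [^] n \<otimes> inv w) = c [^] (n * k)"
      using yG w c by (simp add: nat_pow_inv m_assoc flip: m_assoc[of "y [^] n" w] m_assoc[of "y [^] n" "inv (y [^] n)"])
    moreover have "w \<otimes> (inv y [^] n \<otimes> b) \<otimes> inv w = (w \<otimes> inv y [^] n \<otimes> inv w) \<otimes> b"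
      using yG w b A_central[of b "inv w"] by (simp add: m_assoc)
    moreover have "(y [^] n \<otimes> a) \<otimes> ((w \<otimes> inv y [^] n \<otimes> inv w) \<otimes> b)
        = (y [^] n \<otimes> (w \<otimes> inv y [^] n \<otimes> inv w)) \<otimes> (a \<otimes> b)"
      using yG w a b by (intro mult_exchange) auto
    ultimately show ?thesis using conj[OF w b(2)] M_mult[OF a(2)] by metis
  qed
  \<comment> \<open>The previous fact at \<open>k\<^sup>2\<close> has the quadratic exponent; for
    \<open>k > 0\<close>, another \<open>k - 1\<close> factors of the error from \<open>M\<close>
    give the form required by \<open>absorbed\<close>.\<close>
  have "c [^] (n * k\<^sup>2) \<otimes> (a \<otimes> b) [^] (1 * k) \<in> M" for k :: nat
  proof (cases k)
    case 0 then show ?thesis by (simp add: M_one)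
  next
    case (Suc j)
    have "c [^] (n * k\<^sup>2) \<otimes> (a \<otimes> b) [^] (1 * k) = (c [^] (n * k\<^sup>2) \<otimes> (a \<otimes> b)) \<otimes> (a \<otimes> b) [^] j"
      using c(2) z A_closed A_pow unfolding Suc by (simp only: nat_pow_Suc2 mult_1 IntD2 m_assoc nat_pow_closed m_closed)
    then show ?thesis using base[of "k\<^sup>2"] z by (simp add: M_mult M_pow)
  qed
  then have "c \<in> absorbed (a \<otimes> b)" using c n by (intro absorbedI[of c n "a \<otimes> b" 1]) auto
  then show ?thesis using z by blast
qed

text \<open>Without conjugation the commutator is assembled from elements of \<open>M\<close>
  replacing all four letters. Their \<open>k\<close>-th powers multiply to the commutator of
  \<open>y [^] (n * k)\<close> and \<open>g [^] (n * k)\<close>, which is quadratic in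
  \<open>k\<close>, times \<open>z [^] k\<close>, where \<open>z\<close> collects the four
  corrections.\<close>

lemma commutator_absorbed_if_power_split:
  assumes y: "y \<in> power_split" "inv y \<in> power_split" and g: "g \<in> power_split" "inv g \<in> power_split"
    and c: "c = y \<otimes> g \<otimes> inv y \<otimes> inv g" "c \<in> A"
  shows "\<exists>z \<in> M \<inter> A. c \<in> absorbed z"
proof -
  have G: "y \<in> carrier G" "g \<in> carrier G" using y g by (simp_all add: power_split_def)
  obtain n :: nat where n: "n > 0" "\<forall>h \<in> {y, inv y, g, inv g}. \<exists>a \<in> A. h [^] n \<otimes> a \<in> M"
    using power_split_common_exponent[of "{y, inv y, g, inv g}"] y g by auto
  then obtain a a' b b' where a: "a \<in> A" "y [^] n \<otimes> a \<in> M" and a': "a' \<in> A" "inv y [^] n \<otimes> a' \<in> M"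
    and b: "b \<in> A" "g [^] n \<otimes> b \<in> M" and b': "b' \<in> A" "inv g [^] n \<otimes> b' \<in> M"
    by auto
  define z where "z = (a \<otimes> b) \<otimes> (a' \<otimes> b')"
  have comm: "y \<otimes> g = c \<otimes> (g \<otimes> y)" using G by (simp add: c m_assoc flip: m_assoc[of "inv g" g y])
  have prod: "c [^] (n\<^sup>2 * k\<^sup>2) \<otimes> z [^] (1 * k) \<in> M" for k :: nat
  proof -
    let ?N = "n * k"
    have "(y [^] n \<otimes> a) [^] k \<otimes> (g [^] n \<otimes> b) [^] k = (y [^] ?N \<otimes> g [^] ?N) \<otimes> (a [^] k \<otimes> b [^] k)"
      using G a b A_pow by (simp add: pow_mult_A nat_pow_pow) (subst mult_exchange, auto)
    moreover have "(inv y [^] n \<otimes> a') [^] k \<otimes> (inv g [^] n \<otimes> b') [^] k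
        = (inv y [^] ?N \<otimes> inv g [^] ?N) \<otimes> (a' [^] k \<otimes> b' [^] k)"
      using G a' b' A_pow by (simp add: pow_mult_A nat_pow_pow) (subst mult_exchange, auto)
    moreover have "(y [^] ?N \<otimes> g [^] ?N) \<otimes> (a [^] k \<otimes> b [^] k) \<otimes>
          ((inv y [^] ?N \<otimes> inv g [^] ?N) \<otimes> (a' [^] k \<otimes> b' [^] k))
        = (y [^] ?N \<otimes> g [^] ?N) \<otimes> (inv y [^] ?N \<otimes> inv g [^] ?N) \<otimes>
          ((a [^] k \<otimes> b [^] k) \<otimes> (a' [^] k \<otimes> b' [^] k))"
      using G a b a' b' A_pow A_mult by (intro mult_exchange) auto
    moreover have "(a [^] k \<otimes> b [^] k) \<otimes> (a' [^] k \<otimes> b' [^] k) = z [^] k"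
      unfolding z_def using a b a' b' A_mult by (simp add: pow_mult_A)
    moreover have "(y [^] ?N \<otimes> g [^] ?N) \<otimes> (inv y [^] ?N \<otimes> inv g [^] ?N) = c [^] (?N * ?N)"
    proof -
      have "y [^] ?N \<otimes> g [^] ?N = c [^] (?N * ?N) \<otimes> (g [^] ?N \<otimes> y [^] ?N)"
        by (rule pow_mult_pow_central) (use G c A_central comm in auto)
      moreover have "g [^] ?N \<otimes> y [^] ?N \<otimes> (inv y [^] ?N \<otimes> inv g [^] ?N) = \<one>"
      proof -
        have "y [^] ?N \<otimes> (inv y [^] ?N \<otimes> inv g [^] ?N) = inv g [^] ?N"
          using G by (simp add: nat_pow_inv flip: m_assoc)
        then show ?thesis using G by (simp add: m_assoc nat_pow_inv)
      qed
      ultimately show ?thesis using G c by (simp add: m_assoc)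
    qed
    ultimately have "c [^] (?N * ?N) \<otimes> z [^] k
        = ((y [^] n \<otimes> a) [^] k \<otimes> (g [^] n \<otimes> b) [^] k) \<otimes> ((inv y [^] n \<otimes> a') [^] k \<otimes> (inv g [^] n \<otimes> b') [^] k)"
      by simp
    also have "\<dots> \<in> M" by (rule M_mult[OF M_mult[OF M_pow[OF a(2)] M_pow[OF b(2)]] M_mult[OF M_pow[OF a'(2)] M_pow[OF b'(2)]]])
    finally show ?thesis by (simp add: power2_eq_square mult.assoc mult.left_commute)
  qed
  have "z \<in> A" using a b a' b' A_mult by (simp add: z_def)
  \<comment> \<open>The same four elements of \<open>M\<close>, multiplied in an order in which each
    power meets its inverse.\<close>
  moreover have "z \<in> M"
  proof -
    have "(y [^] n \<otimes> a) \<otimes> (inv y [^] n \<otimes> a') = a \<otimes> a'"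
      using G a a' by (subst mult_exchange) (auto simp: nat_pow_inv)
    moreover have "(g [^] n \<otimes> b) \<otimes> (inv g [^] n \<otimes> b') = b \<otimes> b'"
      using G b b' by (subst mult_exchange) (auto simp: nat_pow_inv)
    moreover have "z = (a \<otimes> a') \<otimes> (b \<otimes> b')"
      unfolding z_def using a b a' b' by (intro mult_exchange) auto
    ultimately show ?thesis using M_mult[OF M_mult[OF a(2) a'(2)] M_mult[OF b(2) b'(2)]] by simp
  qed
  moreover have "c \<in> absorbed z" using c n prod by (intro absorbedI[of c "n\<^sup>2" z 1]) auto
  ultimately show ?thesis by blast
qed

text \<open>One step down a central series: \<open>A\<close> is a term of the series modulo the next. In \<open>alt\<close>, the first
  alternative serves left-orders and the second one bi-orders.\<close>

lemma power_in_submonoid_of_commutator_generators: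
  assumes H: "subgroup H G" and split: "H \<subseteq> power_split"
    and alt: "K \<subseteq> H \<or> (K \<subseteq> carrier G \<and> (\<forall>g \<in> carrier G. \<forall>m \<in> M. g \<otimes> m \<otimes> inv g \<in> M))"
    and fin: "finite C" and gen: "generate G C = A"
    and C: "\<And>c. c \<in> C \<Longrightarrow> \<exists>y \<in> H. \<exists>g \<in> K. c = y \<otimes> g \<otimes> inv y \<otimes> inv g"
    and h: "h \<in> H"
  shows "\<exists>n::nat. n > 0 \<and> h [^] n \<in> M"
proof -
  have HG: "H \<subseteq> carrier G" using H by (rule subgroup.subset)
  have split': "u \<in> power_split" "inv u \<in> power_split" if "u \<in> H" for u
    using that split subgroup.m_inv_closed[OF H] by auto
  \<comment> \<open>Allowing \<open>inv g \<in> K\<close> covers the inverses of the generators: the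
    inverse of the commutator of \<open>y\<close> and \<open>g\<close> is that of \<open>y\<close>
    and \<open>inv g\<close>, as shown below.\<close>
  have absorb: "\<exists>z \<in> M \<inter> A. d \<in> absorbed z"
    if "y \<in> H" "g \<in> K \<or> inv g \<in> K" "g \<in> carrier G" "d = y \<otimes> g \<otimes> inv y \<otimes> inv g" "d \<in> A" for y g d
    using alt
  proof
    assume "K \<subseteq> H"
    then have "g \<in> H" using that H by (metis inv_inv subgroup.m_inv_closed subsetD)
    then show ?thesis using that split' by (intro commutator_absorbed_if_power_split[of y g]) auto
  next
    assume "K \<subseteq> carrier G \<and> (\<forall>g \<in> carrier G. \<forall>m \<in> M. g \<otimes> m \<otimes> inv g \<in> M)"
    then show ?thesis using that split' by (intro commutator_absorbed_if_conjugation_closed[of y g]) auto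
  qed
  have KG: "K \<subseteq> carrier G" using alt HG by auto
  have CA: "C \<subseteq> A" using gen generate.incl[of _ C G] by auto
  have abs: "\<exists>z \<in> M \<inter> A. c \<in> absorbed z" "\<exists>z \<in> M \<inter> A. inv c \<in> absorbed z" if "c \<in> C" for c
  proof -
    obtain y g where yg: "y \<in> H" "g \<in> K" "c = y \<otimes> g \<otimes> inv y \<otimes> inv g" using C \<open>c \<in> C\<close> by blast
    have G: "y \<in> carrier G" "g \<in> carrier G" "c \<in> A" using yg HG KG CA that by auto
    then show "\<exists>z \<in> M \<inter> A. c \<in> absorbed z" using yg absorb by blast
    \<comment> \<open>Conjugating \<open>inv c\<close> by \<open>inv g\<close> yields the commutator
      of \<open>y\<close> and \<open>inv g\<close>, but changes nothing since \<open>c\<close> is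
      central.\<close>
    have "inv g \<otimes> (inv c \<otimes> g) = y \<otimes> inv g \<otimes> inv y \<otimes> inv (inv g)"
      using G yg(3) by (simp add: m_assoc inv_mult_group flip: m_assoc[of "inv g" g])
    moreover have "inv g \<otimes> (inv c \<otimes> g) = inv c"
      using G A_central[of "inv c" g] A_inv by (simp flip: m_assoc)
    ultimately show "\<exists>z \<in> M \<inter> A. inv c \<in> absorbed z"
      using absorb[of y "inv g" "inv c"] G yg A_inv by auto
  qed
  obtain n m a where n: "n > 0" "m \<in> M" "a \<in> A" "h [^] (n::nat) = m \<otimes> a"
    using split h unfolding power_split_def by auto
  obtain s :: nat where s: "s > 0" "a [^] s \<in> M"
    using power_in_submonoid_of_absorbed_generators[OF fin gen abs \<open>a \<in> A\<close>] by blast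
  have "h [^] (n * s) = m [^] s \<otimes> a [^] s"
    using n h HG by (subst nat_pow_pow[symmetric]) (auto simp: pow_mult_A)
  then have "h [^] (n * s) \<in> M" using n s by (simp add: M_mult M_pow)
  then show ?thesis using n s by (intro exI[of _ "n * s"]) simp
qed

end

section \<open>Iterated commutators of generators\<close>

definition word_prod :: "('a, 'b) monoid_scheme \<Rightarrow> 'a list \<Rightarrow> 'a"
  where "word_prod G ws = foldr (\<otimes>\<^bsub>G\<^esub>) ws \<one>\<^bsub>G\<^esub>"

lemma word_prod_Nil [simp]: "word_prod G [] = \<one>\<^bsub>G\<^esub>"
  and word_prod_Cons [simp]: "word_prod G (w # ws) = w \<otimes>\<^bsub>G\<^esub> word_prod G ws"
  by (simp_all add: word_prod_def)

lemma (in monoid) word_prod_closed [simp]: "set ws \<subseteq> carrier G \<Longrightarrow> word_prod G ws \<in> carrier G"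
  by (induction ws) auto

lemma (in monoid) word_prod_append:
  "set us \<subseteq> carrier G \<Longrightarrow> set vs \<subseteq> carrier G \<Longrightarrow> word_prod G (us @ vs) = word_prod G us \<otimes> word_prod G vs"
  by (induction us) (auto simp: m_assoc)

lemma (in group_hom) hom_word_prod:
  "set ws \<subseteq> carrier G \<Longrightarrow> h (word_prod G ws) = word_prod H (map h ws)"
  by (induction ws) auto

text \<open>A trivial word stays trivial under cyclic rotation.\<close>

lemma (in group) inv_letter_of_trivial_word:
  assumes "set (us @ f # vs) \<subseteq> carrier G" "word_prod G (us @ f # vs) = \<one>"
  shows "inv f = word_prod G vs \<otimes> word_prod G us"
proof -
  have c: "word_prod G us \<in> carrier G" "f \<in> carrier G" "word_prod G vs \<in> carrier G"
    using assms(1) by auto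
  have "word_prod G us \<otimes> (f \<otimes> word_prod G vs) = \<one>"
    using assms by (simp add: word_prod_append)
  then have "(f \<otimes> word_prod G vs) \<otimes> word_prod G us = \<one>" using c by (meson inv_comm m_closed)
  then show ?thesis using c by (intro inv_equality inv_comm[of f]) (auto simp: m_assoc)
qed

text \<open>Centralizers are subgroups; this is used on the left factor, then on the right one. It
  reduces centrality of the factors of a series to generators.\<close>

lemma (in group) commute_generate:
  assumes "U \<subseteq> carrier G" "V \<subseteq> carrier G" and comm: "\<And>u v. u \<in> U \<Longrightarrow> v \<in> V \<Longrightarrow> u \<otimes> v = v \<otimes> u"
    and "a \<in> generate G U" "b \<in> generate G V"
  shows "a \<otimes> b = b \<otimes> a"
proof -
  have inv_comm': "inv u \<otimes> v = v \<otimes> inv u" if "u \<otimes> v = v \<otimes> u" "u \<in> carrier G" "v \<in> carrier G" for u v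
    using that by (metis inv_closed inv_solve_left m_assoc m_closed inv_solve_right)
  have mult_comm': "(u \<otimes> w) \<otimes> v = v \<otimes> (u \<otimes> w)"
    if "u \<otimes> v = v \<otimes> u" "w \<otimes> v = v \<otimes> w" "u \<in> carrier G" "v \<in> carrier G" "w \<in> carrier G" for u v w
    using that by (metis m_assoc)
  have a: "a \<otimes> v = v \<otimes> a" if "v \<in> V" for v
    using assms(4)
  proof (induction rule: generate.induct)
    case (eng h1 h2)
    then show ?case using mult_comm'[of h1 v h2] that assms generate_in_carrier by blast
  next
    case (inv h)
    then show ?case using inv_comm'[of h v] that assms by blast
  qed (use that assms in auto)
  show ?thesis
    using assms(5)
  proof (induction rule: generate.induct)
    case (eng h1 h2)
    then show ?case using mult_comm'[of h1 a h2] assms generate_in_carrier by metis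
  next
    case (inv h)
    then show ?case using inv_comm'[of h a] a[of h] assms generate_in_carrier[of U a] by (metis subsetD)
  qed (use a assms generate_in_carrier[of U a] in auto)
qed

lemma (in group) conjugate_generate:
  assumes "g \<in> carrier G" "U \<subseteq> carrier G" "subgroup S G"
    and U: "\<And>u. u \<in> U \<Longrightarrow> g \<otimes> u \<otimes> inv g \<in> S" and "h \<in> generate G U"
  shows "g \<otimes> h \<otimes> inv g \<in> S"
  using assms(5)
proof (induction rule: generate.induct)
  case one then show ?case using assms by (simp add: subgroup.one_closed)
next
  case (incl h) then show ?case by (rule U)
next
  case (inv h)
  have "h \<in> carrier G" using inv assms by auto
  then have "g \<otimes> inv h \<otimes> inv g = inv (g \<otimes> h \<otimes> inv g)" using assms by (simp add: inv_mult_group m_assoc)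
  then show ?case using inv U assms(3) subgroup.m_inv_closed by metis
next
  case (eng h1 h2)
  have "h1 \<in> carrier G" "h2 \<in> carrier G" using eng assms(2) generate_in_carrier by auto
  then have "g \<otimes> (h1 \<otimes> h2) \<otimes> inv g = (g \<otimes> h1 \<otimes> inv g) \<otimes> (g \<otimes> h2 \<otimes> inv g)"
    using assms(1) by (simp add: m_assoc flip: m_assoc[of "inv g" g])
  then show ?case using eng assms(3) subgroup.m_closed by metis
qed

text \<open>Left-normed commutators whose later entries come from \<open>B\<close> only, so that
  every level is finite if \<open>B\<close> and \<open>Y\<close> are; \<open>lower_central\<close>
  admits arbitrary entries instead.\<close>

primrec iterated_commutators :: "('a, 'b) monoid_scheme \<Rightarrow> 'a set \<Rightarrow> 'a set \<Rightarrow> nat \<Rightarrow> 'a set"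
  where
    "iterated_commutators G B Y 0 = Y"
  | "iterated_commutators G B Y (Suc n) = (\<Union>y \<in> iterated_commutators G B Y n. \<Union>g \<in> B.
        {y \<otimes>\<^bsub>G\<^esub> g \<otimes>\<^bsub>G\<^esub> inv\<^bsub>G\<^esub> y \<otimes>\<^bsub>G\<^esub> inv\<^bsub>G\<^esub> g})"

locale finitely_generated_nilpotent = group G for G (structure) +
  fixes B Y :: "'a set"
  assumes B_finite: "finite B"
    and B_carrier: "B \<subseteq> carrier G"
    and B_generates: "generate G B = carrier G"
    and Y_subset: "Y \<subseteq> B"
    and nilpotent: "\<exists>c. iterated_commutators G B Y c \<subseteq> {\<one>}"
begin

abbreviation "commutators \<equiv> iterated_commutators G B Y"

text \<open>All deeper levels are included because level \<open>i\<close> alone need not generate a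
  normal subgroup. With them, \<open>series 0\<close> is the normal closure of
  \<open>Y\<close>.\<close>

definition tail :: "nat \<Rightarrow> 'a set"
  where "tail i = {u. \<exists>j \<ge> i. u \<in> commutators j}"

definition series :: "nat \<Rightarrow> 'a set"
  where "series i = generate G (tail i)"

lemma commutators_carrier: "commutators i \<subseteq> carrier G"
  using B_carrier Y_subset by (induction i) (auto simp: subset_iff)

lemma commutators_finite: "finite (commutators i)"
  using B_finite Y_subset finite_subset by (induction i) auto

lemma tail_carrier: "tail i \<subseteq> carrier G"
  using commutators_carrier by (auto simp: tail_def)

lemma tail_eq: "tail i = commutators i \<union> tail (Suc i)"
proof
  show "tail i \<subseteq> commutators i \<union> tail (Suc i)"
  proof
    fix u assume "u \<in> tail i"
    then obtain j where j: "i \<le> j" "u \<in> commutators j" unfolding tail_def by blast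
    then show "u \<in> commutators i \<union> tail (Suc i)"
      by (cases "j = i") (auto simp: tail_def Suc_le_eq)
  qed
next
  show "commutators i \<union> tail (Suc i) \<subseteq> tail i"
    unfolding tail_def using Suc_leD by blast
qed

lemma tail_Suc:
  assumes "u \<in> tail (Suc i)"
  shows "\<exists>y \<in> tail i. \<exists>g \<in> B. u = y \<otimes> g \<otimes> inv y \<otimes> inv g"
proof -
  obtain j where j: "j \<ge> Suc i" "u \<in> commutators j" using assms by (auto simp: tail_def)
  then obtain k where "j = Suc k" "k \<ge> i" by (cases j) auto
  then show ?thesis using j unfolding tail_def by auto
qed

lemma commutators_vanish: "\<exists>c. \<forall>i \<ge> c. commutators i \<subseteq> {\<one>}"
proof -
  obtain c where c: "commutators c \<subseteq> {\<one>}" using nilpotent by blast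
  have "commutators i \<subseteq> {\<one>}" if "i \<ge> c" for i
    using that
  proof (induction i rule: dec_induct)
    case base then show ?case by (rule c)
  next
    case (step i)
    then show ?case using B_carrier by (fastforce simp: subset_iff)
  qed
  then show ?thesis by blast
qed

lemma series_subgroup: "subgroup (series i) G"
  unfolding series_def using tail_carrier by (rule generate_is_subgroup)

lemma series_antimono: "i \<le> j \<Longrightarrow> series j \<subseteq> series i"
  unfolding series_def tail_def by (rule mono_generate) (blast intro: le_trans)

lemma tail_subset_series: "tail i \<subseteq> series i"
  unfolding series_def by (auto intro: generate.incl)

lemma series_vanish: "\<exists>c>0. \<forall>i \<ge> c. series i = {\<one>}"
proof -
  obtain c where c: "\<And>i. i \<ge> c \<Longrightarrow> commutators i \<subseteq> {\<one>}" using commutators_vanish by blast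
  \<comment> \<open>\<open>Suc c\<close> keeps the bound positive, as the descent will start at
    index 1.\<close>
  have "series i = {\<one>}" if "i \<ge> Suc c" for i
  proof -
    have "tail i \<subseteq> {\<one>}" using c that unfolding tail_def by (blast dest: Suc_leD le_trans)
    then have "series i \<subseteq> {\<one>}" unfolding series_def
      using mono_generate[of "tail i" "{\<one>}"] generate_one by auto
    then show ?thesis using subgroup.one_closed[OF series_subgroup[of i]] by auto
  qed
  then show ?thesis by blast
qed

text \<open>Downward induction from an index where the series is trivial: conjugating
  \<open>u\<close> by a generator \<open>g\<close> alters it by a commutator from the next term,
  which is already known to be normal.\<close>

lemma series_normal: "series i \<lhd> G"
proof -
  obtain c where c: "\<And>i. i \<ge> c \<Longrightarrow> series i = {\<one>}" using series_vanish by blast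
  show ?thesis
  proof (cases "i \<ge> c")
    case True then show ?thesis using c one_is_normal by simp
  next
    case False
    then have "i \<le> c" by simp
    then show ?thesis
    proof (induction i rule: inc_induct)
      case base then show ?case using c one_is_normal by simp
    next
      case (step i)
      have sub: "series (Suc i) \<subseteq> series i" by (rule series_antimono) simp
      have conj_Suc: "g \<otimes> h \<otimes> inv g \<in> series (Suc i)" if "g \<in> carrier G" "h \<in> series (Suc i)" for g h
        using step.IH that normal_inv_iff by blast
      have comm: "y \<otimes> g \<otimes> inv y \<otimes> inv g \<in> series (Suc i)" if "y \<in> commutators i" "g \<in> B" for y g
        using that tail_subset_series[of "Suc i"] tail_eq[of "Suc i"] by fastforce
      have gen: "g \<otimes> u \<otimes> inv g \<in> series i" "inv g \<otimes> u \<otimes> inv (inv g) \<in> series i"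
        if g: "g \<in> B" and u: "u \<in> tail i" for g u
      proof -
        have G: "g \<in> carrier G" "u \<in> carrier G" using g u B_carrier tail_carrier by auto
        have "g \<otimes> u \<otimes> inv g \<in> series i \<and> inv g \<otimes> u \<otimes> inv (inv g) \<in> series i"
        proof (cases "u \<in> tail (Suc i)")
          case True
          then have "u \<in> series (Suc i)" using tail_subset_series by blast
          then show ?thesis using conj_Suc G sub by (meson inv_closed subsetD)
        next
          case False
          then have u': "u \<in> commutators i" using u tail_eq by blast
          let ?c = "u \<otimes> g \<otimes> inv u \<otimes> inv g"
          have cs: "?c \<in> series (Suc i)" using comm[OF u' g] .
          have us: "u \<in> series i" using u tail_subset_series by blast
          have "inv ?c \<otimes> u = g \<otimes> u \<otimes> inv g"
            using G by (simp add: inv_mult_group m_assoc)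
          moreover have "inv ?c \<otimes> u \<in> series i"
            using cs us sub series_subgroup by (meson subgroup.m_closed subgroup.m_inv_closed subsetD)
          \<comment> \<open>For \<open>inv g\<close> the commutator appears conjugated; normality of
            the next term keeps it there.\<close>
          moreover have "(inv g \<otimes> ?c \<otimes> inv (inv g)) \<otimes> u = inv g \<otimes> u \<otimes> inv (inv g)"
            using G by (simp add: m_assoc)
          moreover have "(inv g \<otimes> ?c \<otimes> inv (inv g)) \<otimes> u \<in> series i"
            using conj_Suc[OF inv_closed[OF G(1)] cs] us sub series_subgroup
            by (meson subgroup.m_closed subsetD)
          ultimately show ?thesis by simp
        qed
        then show "g \<otimes> u \<otimes> inv g \<in> series i" "inv g \<otimes> u \<otimes> inv (inv g) \<in> series i" by auto
      qed
      have "\<forall>h \<in> series i. g \<otimes> h \<otimes> inv g \<in> series i" if "g \<in> generate G B" for g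
        using that
      proof (induction rule: generate.induct)
        case one
        then show ?case using subgroup.mem_carrier[OF series_subgroup] by simp
      next
        case (incl g)
        then show ?case
          using conjugate_generate[OF _ tail_carrier series_subgroup gen(1)] B_carrier
          unfolding series_def by blast
      next
        case (inv g)
        then show ?case
          using conjugate_generate[OF _ tail_carrier series_subgroup gen(2)] B_carrier
          unfolding series_def by (meson inv_closed subsetD)
      next
        case (eng g1 g2)
        have "g1 \<in> carrier G" "g2 \<in> carrier G" using eng B_carrier generate_in_carrier by auto
        then have "(g1 \<otimes> g2) \<otimes> h \<otimes> inv (g1 \<otimes> g2) = g1 \<otimes> (g2 \<otimes> h \<otimes> inv g2) \<otimes> inv g1"
          if "h \<in> series i" for h
          using subgroup.mem_carrier[OF series_subgroup that] by (simp add: inv_mult_group m_assoc)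
        then show ?case using eng by simp
      qed
      then show ?case using B_generates series_subgroup normal_inv_iff by metis
    qed
  qed
qed

end

section \<open>Descent along the commutator series\<close>

context finitely_generated_nilpotent
begin

abbreviation quotient :: "nat \<Rightarrow> 'a set monoid"
  where "quotient i \<equiv> G Mod series i"

abbreviation proj :: "nat \<Rightarrow> 'a \<Rightarrow> 'a set"
  where "proj i \<equiv> (#>) (series i)"

lemma proj_hom: "group_hom G (quotient i) (proj i)"
  using normal.r_coset_hom_Mod[OF series_normal] normal.factorgroup_is_group[OF series_normal]
  by (simp add: group_hom_def group_hom_axioms_def is_group)

lemma proj_eq_one: "h \<in> series i \<Longrightarrow> proj i h = \<one>\<^bsub>quotient i\<^esub>"
  using subgroup.rcos_const[OF series_subgroup is_group] by simp

lemma proj_eqD: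
  assumes "proj i g = proj i h" "g \<in> carrier G" "h \<in> carrier G"
  shows "\<exists>t \<in> series i. g = t \<otimes> h"
proof -
  have "g \<in> series i #> h"
    using assms by (intro repr_independenceD[OF series_subgroup]) auto
  then show ?thesis by (auto simp: r_coset_def)
qed

text \<open>Deeper commutators die in the quotient, so only the finite level \<open>i\<close> and
  the identity remain.\<close>

lemma proj_tail_finite: "finite (proj (Suc i) ` tail i)"
proof -
  have "proj (Suc i) ` tail i \<subseteq> insert \<one>\<^bsub>quotient (Suc i)\<^esub> (proj (Suc i) ` commutators i)"
    using proj_eq_one[of _ "Suc i"] tail_subset_series[of "Suc i"] unfolding tail_eq[of i] by blast
  then show ?thesis using commutators_finite finite_subset by blast
qed

lemma generate_proj_tail: "generate (quotient j) (proj j ` tail i) = proj j ` series i"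
  unfolding series_def[of i] using group_hom.generate_img[OF proj_hom tail_carrier] .

lemma proj_tail_commute:
  assumes "u \<in> tail i" "g \<in> B"
  shows "proj (Suc i) u \<otimes>\<^bsub>quotient (Suc i)\<^esub> proj (Suc i) g
       = proj (Suc i) g \<otimes>\<^bsub>quotient (Suc i)\<^esub> proj (Suc i) u"
proof -
  interpret proj: group_hom G "quotient (Suc i)" "proj (Suc i)" by (rule proj_hom)
  have G: "u \<in> carrier G" "g \<in> carrier G" using assms tail_carrier B_carrier by auto
  show ?thesis
  proof (cases "u \<in> tail (Suc i)")
    case True
    then have "proj (Suc i) u = \<one>\<^bsub>quotient (Suc i)\<^esub>"
      using proj_eq_one tail_subset_series by blast
    then show ?thesis using G by (metis proj.H.l_one proj.H.r_one proj.hom_closed)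
  next
    case False
    then have "u \<otimes> g \<otimes> inv u \<otimes> inv g \<in> tail (Suc i)"
      using assms tail_eq[of i] tail_eq[of "Suc i"] by auto
    then have *: "proj (Suc i) (u \<otimes> g \<otimes> inv u \<otimes> inv g) = \<one>\<^bsub>quotient (Suc i)\<^esub>"
      using proj_eq_one tail_subset_series by blast
    have "u \<otimes> g = (u \<otimes> g \<otimes> inv u \<otimes> inv g) \<otimes> (g \<otimes> u)"
      using G by (simp add: m_assoc flip: m_assoc[of "inv g" g u])
    then have "proj (Suc i) (u \<otimes> g) = proj (Suc i) (g \<otimes> u)"
      using * G by (metis inv_closed m_closed proj.H.l_one proj.hom_closed proj.hom_mult)
    then show ?thesis using G by (metis proj.hom_mult)
  qed
qed

text \<open>Only centrality has content: the images of \<open>tail i\<close> and \<open>B\<close>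
  generate the two groups concerned and commute elementwise.\<close>

lemma quotient_submonoid_and_central_subgroup:
  assumes M: "M \<subseteq> carrier G" "\<one> \<in> M" "\<And>u v. u \<in> M \<Longrightarrow> v \<in> M \<Longrightarrow> u \<otimes> v \<in> M"
  shows "submonoid_and_central_subgroup (quotient (Suc i)) (proj (Suc i) ` M) (proj (Suc i) ` series i)"
proof -
  interpret proj: group_hom G "quotient (Suc i)" "proj (Suc i)" by (rule proj_hom)
  show ?thesis
  proof (rule submonoid_and_central_subgroup.intro, rule proj.H.is_group, rule submonoid_and_central_subgroup_axioms.intro)
    show "proj (Suc i) ` M \<subseteq> carrier (quotient (Suc i))" using M by auto
    show "\<one>\<^bsub>quotient (Suc i)\<^esub> \<in> proj (Suc i) ` M" using M(2) proj.hom_one by (metis imageI)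
    show "u \<otimes>\<^bsub>quotient (Suc i)\<^esub> v \<in> proj (Suc i) ` M"
      if uv: "u \<in> proj (Suc i) ` M" "v \<in> proj (Suc i) ` M" for u v
    proof -
      obtain a b where "a \<in> M" "b \<in> M" "u = proj (Suc i) a" "v = proj (Suc i) b" using uv by blast
      then show ?thesis using M proj.hom_mult[of a b] by (metis imageI subsetD)
    qed
    show "subgroup (proj (Suc i) ` series i) (quotient (Suc i))"
      by (rule proj.subgroup_img_is_subgroup[OF series_subgroup])
    show "a \<otimes>\<^bsub>quotient (Suc i)\<^esub> u = u \<otimes>\<^bsub>quotient (Suc i)\<^esub> a"
      if "a \<in> proj (Suc i) ` series i" "u \<in> carrier (quotient (Suc i))" for a u
    proof (rule proj.H.commute_generate[of "proj (Suc i) ` tail i" "proj (Suc i) ` B"])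
      show "a \<in> generate (quotient (Suc i)) (proj (Suc i) ` tail i)"
        using that generate_proj_tail by simp
      have "carrier (quotient (Suc i)) = proj (Suc i) ` carrier G"
        by (auto simp: carrier_FactGroup)
      then show "u \<in> generate (quotient (Suc i)) (proj (Suc i) ` B)"
        using that(2) B_generates proj.generate_img[OF B_carrier] by simp
      show "proj (Suc i) ` tail i \<subseteq> carrier (quotient (Suc i))" using tail_carrier[of i] by auto
      show "proj (Suc i) ` B \<subseteq> carrier (quotient (Suc i))" using B_carrier by auto
      show "u \<otimes>\<^bsub>quotient (Suc i)\<^esub> v = v \<otimes>\<^bsub>quotient (Suc i)\<^esub> u"
        if "u \<in> proj (Suc i) ` tail i" "v \<in> proj (Suc i) ` B" for u v
        using that by (elim imageE) (simp only: proj_tail_commute)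
    qed
  qed
qed

text \<open>The invariant of the descent. Once \<open>series i\<close> is trivial, it says that
  \<open>M\<close> contains a positive power of every element of \<open>series 0\<close>.\<close>

definition powers_meet :: "'a set \<Rightarrow> nat \<Rightarrow> bool"
  where "powers_meet M i \<longleftrightarrow>
    (\<forall>h \<in> series 0. \<exists>n::nat. n > 0 \<and> (\<exists>m \<in> M. proj i (h [^] n) = proj i m))"

text \<open>The one-step lemma is applied modulo \<open>series (Suc i)\<close>. Index 0 is excluded
  because the generators of \<open>series i\<close> must be commutators, while those of
  \<open>series 0\<close> include \<open>Y\<close>.\<close>

lemma powers_meet_Suc:
  assumes M: "M \<subseteq> carrier G" "\<one> \<in> M" "\<And>u v. u \<in> M \<Longrightarrow> v \<in> M \<Longrightarrow> u \<otimes> v \<in> M"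
    and alt: "B \<subseteq> series 0 \<or> (\<forall>g \<in> carrier G. \<forall>m \<in> M. g \<otimes> m \<otimes> inv g \<in> M)"
    and i: "i > 0" and meet: "powers_meet M i"
  shows "powers_meet M (Suc i)"
proof -
  let ?Q = "quotient (Suc i)" and ?q = "proj (Suc i)"
  interpret proj: group_hom G ?Q ?q by (rule proj_hom)
  interpret Q: submonoid_and_central_subgroup ?Q "?q ` M" "?q ` series i"
    using M by (rule quotient_submonoid_and_central_subgroup)
  have s0: "series 0 \<subseteq> carrier G" using series_subgroup subgroup.subset by blast
  show ?thesis
    unfolding powers_meet_def
  proof
    fix h assume h: "h \<in> series 0"
    have split: "?q ` series 0 \<subseteq> Q.power_split"
    proof
      fix x assume "x \<in> ?q ` series 0"
      then obtain h where h: "h \<in> series 0" "x = ?q h" by blast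
      then obtain n m where n: "n > 0" "m \<in> M" "proj i (h [^] (n::nat)) = proj i m"
        using meet unfolding powers_meet_def by blast
      have hG: "h \<in> carrier G" using h s0 by blast
      \<comment> \<open>The power agrees with \<open>m\<close> up to an element of
        \<open>series i\<close>, whose image is central, as \<open>power_split\<close>
        demands.\<close>
      obtain t where t: "t \<in> series i" "h [^] n = t \<otimes> m"
        using proj_eqD[OF n(3)] hG n(2) M(1) by auto
      have tG: "t \<in> carrier G" "m \<in> carrier G" using t n M subgroup.mem_carrier[OF series_subgroup] by auto
      have "x [^]\<^bsub>?Q\<^esub> n = ?q m \<otimes>\<^bsub>?Q\<^esub> ?q t"
        using Q.A_central[of "?q t" "?q m"] t tG hG h proj.hom_nat_pow[of h n] proj.hom_mult[of t m]
        by (metis imageI proj.hom_closed)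
      then show "x \<in> Q.power_split"
        unfolding Q.power_split_def using n t h hG by auto
    qed
    have alt': "?q ` B \<subseteq> ?q ` series 0 \<or> (?q ` B \<subseteq> carrier ?Q \<and>
        (\<forall>g \<in> carrier ?Q. \<forall>m \<in> ?q ` M. g \<otimes>\<^bsub>?Q\<^esub> m \<otimes>\<^bsub>?Q\<^esub> inv\<^bsub>?Q\<^esub> g \<in> ?q ` M))"
      using alt
    proof
      assume c: "\<forall>g \<in> carrier G. \<forall>m \<in> M. g \<otimes> m \<otimes> inv g \<in> M"
      have "g \<otimes>\<^bsub>?Q\<^esub> m \<otimes>\<^bsub>?Q\<^esub> inv\<^bsub>?Q\<^esub> g \<in> ?q ` M" if gm: "g \<in> carrier ?Q" "m \<in> ?q ` M" for g m
      proof -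
        obtain k u where ku: "k \<in> carrier G" "g = ?q k" "u \<in> M" "m = ?q u"
          using gm by (auto simp: carrier_FactGroup)
        moreover have "u \<in> carrier G" using ku M(1) by blast
        ultimately have "?q (k \<otimes> u \<otimes> inv k) = g \<otimes>\<^bsub>?Q\<^esub> m \<otimes>\<^bsub>?Q\<^esub> inv\<^bsub>?Q\<^esub> g"
          by (simp only: m_closed inv_closed proj.hom_mult proj.hom_inv)
        then show ?thesis using c ku by (metis imageI)
      qed
      moreover have "?q ` B \<subseteq> carrier ?Q" using B_carrier by auto
      ultimately show ?thesis by blast
    qed blast
    have C: "\<exists>y \<in> ?q ` series 0. \<exists>g \<in> ?q ` B. c = y \<otimes>\<^bsub>?Q\<^esub> g \<otimes>\<^bsub>?Q\<^esub> inv\<^bsub>?Q\<^esub> y \<otimes>\<^bsub>?Q\<^esub> inv\<^bsub>?Q\<^esub> g"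
      if c: "c \<in> ?q ` tail i" for c
    proof -
      obtain k where k: "i = Suc k" using i by (cases i) auto
      obtain u where u: "u \<in> tail (Suc k)" "c = ?q u" using c k by blast
      obtain y g where yg: "y \<in> tail k" "g \<in> B" "u = y \<otimes> g \<otimes> inv y \<otimes> inv g"
        using tail_Suc[OF u(1)] by blast
      have "y \<in> series 0" using yg tail_subset_series[of k] series_antimono[of 0 k] by auto
      moreover have "y \<in> carrier G" "g \<in> carrier G" using yg tail_carrier B_carrier by auto
      then have "c = ?q y \<otimes>\<^bsub>?Q\<^esub> ?q g \<otimes>\<^bsub>?Q\<^esub> inv\<^bsub>?Q\<^esub> (?q y) \<otimes>\<^bsub>?Q\<^esub> inv\<^bsub>?Q\<^esub> (?q g)"
        unfolding u(2) yg(3) by (simp only: m_closed inv_closed proj.hom_mult proj.hom_inv)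
      ultimately show ?thesis using yg by blast
    qed
    obtain n where n: "n > 0" "?q h [^]\<^bsub>?Q\<^esub> (n::nat) \<in> ?q ` M"
      using Q.power_in_submonoid_of_commutator_generators[OF proj.subgroup_img_is_subgroup[OF series_subgroup]
          split alt' proj_tail_finite generate_proj_tail C imageI[OF h]] by auto
    have "h \<in> carrier G" using h s0 by blast
    then have "\<exists>m \<in> M. ?q (h [^] n) = ?q m" using n(2) proj.hom_nat_pow[of h n] by auto
    then show "\<exists>n::nat. n > 0 \<and> (\<exists>m \<in> M. ?q (h [^] n) = ?q m)" using n(1) by blast
  qed
qed

lemma powers_in_submonoid:
  assumes M: "M \<subseteq> carrier G" "\<one> \<in> M" "\<And>u v. u \<in> M \<Longrightarrow> v \<in> M \<Longrightarrow> u \<otimes> v \<in> M"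
    and alt: "B \<subseteq> series 0 \<or> (\<forall>g \<in> carrier G. \<forall>m \<in> M. g \<otimes> m \<otimes> inv g \<in> M)"
    and meet: "powers_meet M 1" and h: "h \<in> series 0"
  shows "\<exists>n::nat. n > 0 \<and> h [^] n \<in> M"
proof -
  obtain c where c: "c > 0" "series c = {\<one>}" using series_vanish by blast
  have "powers_meet M i" if "1 \<le> i" for i
    using that
  proof (induction i rule: dec_induct)
    case base show ?case by (rule meet)
  next
    case (step i)
    then show ?case using powers_meet_Suc[OF M alt] by simp
  qed
  then have "powers_meet M c" using c by simp
  then obtain n m where n: "n > 0" "m \<in> M" "proj c (h [^] (n::nat)) = proj c m"
    using h unfolding powers_meet_def by blast
  have hG: "h \<in> carrier G" by (rule subgroup.mem_carrier[OF series_subgroup h])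
  have "h [^] n = m" using proj_eqD[OF n(3)] hG n M(1) c by auto
  then show ?thesis using n by blast
qed

end

section \<open>Trivial words modulo commutators\<close>

context submonoid_and_central_subgroup
begin

text \<open>An analogue, for a submonoid, of the isolator of a subgroup. Here \<open>A\<close> will
  be the image of \<open>series 0\<close> modulo \<open>series 1\<close>.\<close>

definition roots :: "'a set"
  where "roots = {a \<in> A. \<exists>n::nat. n > 0 \<and> a [^] n \<in> M}"

lemma roots_mult:
  assumes "a \<in> roots" "b \<in> roots"
  shows "a \<otimes> b \<in> roots"
proof -
  obtain n m :: nat where n: "n > 0" "a [^] n \<in> M" and m: "m > 0" "b [^] m \<in> M"
    using assms unfolding roots_def by blast
  have A: "a \<in> A" "b \<in> A" using assms by (auto simp: roots_def)
  have "(a \<otimes> b) [^] (n * m) = (a [^] n) [^] m \<otimes> (b [^] m) [^] n"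
    using A by (simp add: pow_mult_A nat_pow_pow mult.commute)
  then have "(a \<otimes> b) [^] (n * m) \<in> M" using n m by (simp add: M_mult M_pow)
  then show ?thesis using A A_mult n m unfolding roots_def by (auto intro!: exI[of _ "n * m"])
qed

lemma submonoid_subset_roots: "M \<inter> A \<subseteq> roots"
proof
  fix a assume "a \<in> M \<inter> A"
  then show "a \<in> roots" unfolding roots_def by (auto intro!: exI[of _ "1::nat"])
qed

lemma word_prod_in_roots: "set ws \<subseteq> roots \<Longrightarrow> word_prod G ws \<in> roots"
  using submonoid_subset_roots M_one A_one by (induction ws) (auto intro: roots_mult)

text \<open>All letters are central, so the occurrences of \<open>x\<close> can be collected in
  front.\<close>

lemma word_prod_eq_pow_mult:
  assumes "x \<in> A" "set ws \<subseteq> insert x (M \<inter> A)"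
  shows "\<exists>j::nat. \<exists>m \<in> M. word_prod G ws = x [^] j \<otimes> m"
  using assms(2)
proof (induction ws)
  case Nil
  then show ?case using M_one by (intro exI[of _ 0] bexI[of _ \<one>]) auto
next
  case (Cons w ws)
  then obtain j :: nat and m where jm: "m \<in> M" "word_prod G ws = x [^] j \<otimes> m" by auto
  have xG: "x \<in> carrier G" "m \<in> carrier G" using assms jm by auto
  show ?case
  proof (cases "w = x")
    case True
    then have "word_prod G (w # ws) = x [^] Suc j \<otimes> m"
      using jm xG by (simp only: word_prod_Cons nat_pow_Suc2 m_assoc nat_pow_closed)
    then show ?thesis using jm by blast
  next
    case False
    then have w: "w \<in> M" "w \<in> A" using Cons.prems by auto
    then have "word_prod G (w # ws) = x [^] j \<otimes> (w \<otimes> m)"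
      using jm xG A_central[of w "x [^] j"] by (simp flip: m_assoc)
    then show ?thesis using jm w M_mult by blast
  qed
qed

text \<open>Rotating the word gives \<open>inv x = x [^] j \<otimes> m\<close>; bringing
  \<open>x [^] j\<close> to the other side leaves \<open>inv x [^] Suc j = m\<close>.\<close>

lemma inv_in_roots_if_letter_of_trivial_word:
  assumes x: "x \<in> A" and ws: "set ws \<subseteq> insert x (M \<inter> A)" "x \<in> set ws" "word_prod G ws = \<one>"
  shows "inv x \<in> roots"
proof -
  obtain us vs where split: "ws = us @ x # vs" using ws(2) by (auto simp: in_set_conv_decomp)
  have sub: "set us \<subseteq> insert x (M \<inter> A)" "set vs \<subseteq> insert x (M \<inter> A)" using ws(1) split by auto
  have "set ws \<subseteq> carrier G" using ws(1) x by auto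
  then have "inv x = word_prod G (vs @ us)"
    using inv_letter_of_trivial_word ws(3) split by (simp add: word_prod_append)
  then obtain j :: nat and m where jm: "m \<in> M" "inv x = x [^] j \<otimes> m"
    using word_prod_eq_pow_mult[OF x, of "vs @ us"] sub by auto
  have G: "x \<in> carrier G" "m \<in> carrier G" using x jm by auto
  have "inv x [^] Suc j = m"
  proof -
    have "inv x [^] Suc j = inv (x [^] j) \<otimes> inv x" using G by (simp add: nat_pow_inv)
    also have "\<dots> = m" unfolding jm(2) using G by (simp flip: m_assoc)
    finally show ?thesis .
  qed
  then show ?thesis using jm x A_inv unfolding roots_def by (metis (mono_tags, lifting) mem_Collect_eq zero_less_Suc)
qed

lemma inv_letter_in_roots:
  assumes ws: "set ws \<subseteq> roots" "f \<in> set ws" "word_prod G ws = \<one>"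
  shows "inv f \<in> roots"
proof -
  obtain us vs where split: "ws = us @ f # vs" using ws(2) by (auto simp: in_set_conv_decomp)
  have "set ws \<subseteq> carrier G" using ws(1) by (auto simp: roots_def)
  then have "inv f = word_prod G vs \<otimes> word_prod G us"
    using inv_letter_of_trivial_word ws(3) split by simp
  also have "\<dots> \<in> roots" using ws(1) split by (intro roots_mult word_prod_in_roots) auto
  finally show ?thesis .
qed

text \<open>The first word puts \<open>inv x\<close> into \<open>roots\<close>, the second one
  \<open>x\<close>. Hence all letters lie in \<open>roots\<close>, and the inverse of each is a
  product of the others.\<close>

lemma letters_in_roots:
  assumes x: "x \<in> A"
    and ws: "set ws \<subseteq> insert x (M \<inter> A)" "x \<in> set ws" "word_prod G ws = \<one>"
    and vs: "set vs \<subseteq> insert (inv x) (M \<inter> A)" "inv x \<in> set vs" "word_prod G vs = \<one>"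
    and f: "f \<in> set ws \<union> set vs"
  shows "f \<in> roots \<and> inv f \<in> roots"
proof -
  have 1: "inv x \<in> roots" using x ws by (rule inv_in_roots_if_letter_of_trivial_word)
  have 2: "x \<in> roots"
    using inv_in_roots_if_letter_of_trivial_word[OF A_inv[OF x] vs] x by simp
  have "set ws \<subseteq> roots" "set vs \<subseteq> roots" using ws vs 1 2 submonoid_subset_roots by auto
  then show ?thesis using f inv_letter_in_roots ws(3) vs(3) by blast
qed

text \<open>The absorption argument with trivial error \<open>z = \<one>\<close>: a power of
  \<open>c [^] n\<close> has no linear term to absorb.\<close>

lemma power_in_submonoid_of_root_generators:
  assumes fin: "finite C" and gen: "generate G C = A"
    and C: "\<And>c. c \<in> C \<Longrightarrow> c \<in> roots \<and> inv c \<in> roots" and a: "a \<in> A"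
  shows "\<exists>n::nat. n > 0 \<and> a [^] n \<in> M"
proof -
  have "c \<in> absorbed \<one>" if c: "c \<in> roots" for c
  proof -
    obtain n :: nat where n: "n > 0" "c [^] n \<in> M" "c \<in> A" using c by (auto simp: roots_def)
    have "c [^] (n * k\<^sup>2) \<otimes> \<one> [^] (0 * k) \<in> M" for k :: nat
      using n M_pow[of "c [^] n" "k\<^sup>2"] by (simp add: nat_pow_pow)
    then show ?thesis using n absorbedI by blast
  qed
  then show ?thesis
    using power_in_submonoid_of_absorbed_generators[OF fin gen _ _ a] C M_one A_one by blast
qed

end

context finitely_generated_nilpotent
begin

text \<open>Modulo \<open>series 1\<close> conjugation acts trivially on \<open>series 0\<close>, so
  the conjugates of \<open>x\<close> and of \<open>inv x\<close> in the two words collapse. The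
  choice of \<open>Y\<close> makes \<open>x\<close> and the letters from \<open>M\<close> generate
  the image of \<open>series 0\<close>.\<close>

lemma powers_meet_1:
  assumes M: "M \<subseteq> carrier G" "\<one> \<in> M" "\<And>u v. u \<in> M \<Longrightarrow> v \<in> M \<Longrightarrow> u \<otimes> v \<in> M"
    and Y: "Y = insert x ((set ws \<union> set vs) \<inter> M)"
    and ws: "set ws \<subseteq> M \<union> (\<lambda>g. g \<otimes> x \<otimes> inv g) ` carrier G"
      "set ws \<inter> (\<lambda>g. g \<otimes> x \<otimes> inv g) ` carrier G \<noteq> {}" "word_prod G ws = \<one>"
    and vs: "set vs \<subseteq> M \<union> (\<lambda>g. g \<otimes> inv x \<otimes> inv g) ` carrier G"
      "set vs \<inter> (\<lambda>g. g \<otimes> inv x \<otimes> inv g) ` carrier G \<noteq> {}" "word_prod G vs = \<one>"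
  shows "powers_meet M 1"
proof -
  let ?Q = "quotient (Suc 0)" and ?q = "proj (Suc 0)"
  interpret proj: group_hom G ?Q ?q by (rule proj_hom)
  interpret Q: submonoid_and_central_subgroup ?Q "?q ` M" "?q ` series 0"
    using M by (rule quotient_submonoid_and_central_subgroup)
  have Ys: "Y \<subseteq> series 0" using tail_subset_series[of 0] tail_eq[of 0] by auto
  have xG: "x \<in> carrier G" using Y Y_subset B_carrier by auto
  have xA: "?q x \<in> ?q ` series 0" using Ys Y by auto
  have conj: "?q (g \<otimes> y \<otimes> inv g) = ?q y" if "g \<in> carrier G" "y \<in> carrier G" "?q y \<in> ?q ` series 0" for g y
  proof -
    have "?q (g \<otimes> y \<otimes> inv g) = ?q g \<otimes>\<^bsub>?Q\<^esub> ?q y \<otimes>\<^bsub>?Q\<^esub> inv\<^bsub>?Q\<^esub> ?q g"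
      using that(1,2) by (simp only: m_closed inv_closed proj.hom_mult proj.hom_inv)
    also have "\<dots> = ?q y \<otimes>\<^bsub>?Q\<^esub> ?q g \<otimes>\<^bsub>?Q\<^esub> inv\<^bsub>?Q\<^esub> ?q g"
      using Q.A_central[OF that(3) proj.hom_closed[OF that(1)]] by (simp only:)
    also have "\<dots> = ?q y"
      using that(1,2) by (simp only: proj.H.m_assoc proj.H.r_inv proj.H.r_one proj.hom_closed proj.H.inv_closed)
    finally show ?thesis .
  qed
  \<comment> \<open>Stated for any \<open>y\<close>, as it serves \<open>ws\<close> with
    \<open>x\<close> and \<open>vs\<close> with \<open>inv x\<close>.\<close>
  have key: "?q ` set us \<subseteq> insert (?q y) (?q ` M \<inter> ?q ` series 0) \<and> ?q y \<in> ?q ` set us \<and>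
      set us \<subseteq> carrier G"
    if us: "set us \<subseteq> M \<union> (\<lambda>g. g \<otimes> y \<otimes> inv g) ` carrier G" "set us \<inter> M \<subseteq> Y"
      "set us \<inter> (\<lambda>g. g \<otimes> y \<otimes> inv g) ` carrier G \<noteq> {}"
      and y: "y \<in> carrier G" "?q y \<in> ?q ` series 0" for us y
  proof (intro conjI)
    show "?q ` set us \<subseteq> insert (?q y) (?q ` M \<inter> ?q ` series 0)"
    proof
      fix w assume "w \<in> ?q ` set us"
      then obtain u where u: "u \<in> set us" "w = ?q u" by blast
      show "w \<in> insert (?q y) (?q ` M \<inter> ?q ` series 0)"
      proof (cases "u \<in> M")
        case True
        then show ?thesis using us(2) u Ys by blast
      next
        case False
        then obtain g where "g \<in> carrier G" "u = g \<otimes> y \<otimes> inv g" using u us by blast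
        then show ?thesis using conj y u by simp
      qed
    qed
    obtain g where g: "g \<in> carrier G" "g \<otimes> y \<otimes> inv g \<in> set us" using us(3) by blast
    then show "?q y \<in> ?q ` set us" using conj[OF g(1) y] by (metis imageI)
    show "set us \<subseteq> carrier G" using us(1) M(1) y by auto
  qed
  have ws': "?q ` set ws \<subseteq> insert (?q x) (?q ` M \<inter> ?q ` series 0)" "?q x \<in> ?q ` set ws"
      "set ws \<subseteq> carrier G"
    using key[OF ws(1) _ ws(2) xG xA] Y by auto
  have invx: "?q (inv x) = inv\<^bsub>?Q\<^esub> ?q x" using xG by simp
  have vs': "?q ` set vs \<subseteq> insert (inv\<^bsub>?Q\<^esub> ?q x) (?q ` M \<inter> ?q ` series 0)" "inv\<^bsub>?Q\<^esub> ?q x \<in> ?q ` set vs"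
      "set vs \<subseteq> carrier G"
    using key[OF vs(1) _ vs(2) inv_closed[OF xG]] Y Q.A_inv[OF xA] unfolding invx by auto
  have letters: "f \<in> Q.roots \<and> inv\<^bsub>?Q\<^esub> f \<in> Q.roots" if "f \<in> ?q ` set ws \<union> ?q ` set vs" for f
    using Q.letters_in_roots[OF xA, of "map ?q ws" "map ?q vs" f] ws' vs' ws(3) vs(3) that
      proj.hom_word_prod[of ws] proj.hom_word_prod[of vs] by auto
  have roots: "c \<in> Q.roots \<and> inv\<^bsub>?Q\<^esub> c \<in> Q.roots" if c: "c \<in> ?q ` tail 0" for c
  proof -
    obtain u where u: "u \<in> tail 0" "c = ?q u" using c by blast
    show ?thesis
    proof (cases "u \<in> tail (Suc 0)")
      case True
      then have "u \<in> series (Suc 0)" using tail_subset_series by blast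
      then have "c = \<one>\<^bsub>?Q\<^esub>" using u(2) proj_eq_one by (simp only:)
      moreover have "\<one>\<^bsub>?Q\<^esub> \<in> Q.roots"
        by (rule subsetD[OF Q.submonoid_subset_roots IntI[OF Q.M_one Q.A_one]])
      ultimately show ?thesis by (simp only: proj.H.inv_one)
    next
      case False
      then have "u \<in> Y" using u tail_eq[of 0] by auto
      then show ?thesis using Y letters[of c] u ws' by auto
    qed
  qed
  show ?thesis
    unfolding powers_meet_def
  proof
    fix h assume h: "h \<in> series 0"
    have hG: "h \<in> carrier G" by (rule subgroup.mem_carrier[OF series_subgroup h])
    obtain n :: nat where n: "n > 0" "?q h [^]\<^bsub>?Q\<^esub> n \<in> ?q ` M"
      using Q.power_in_submonoid_of_root_generators[OF proj_tail_finite generate_proj_tail roots imageI[OF h]]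
      by auto
    then have "\<exists>m \<in> M. proj 1 (h [^] n) = proj 1 m" using proj.hom_nat_pow[OF hG, of n] by auto
    then show "\<exists>n::nat. n > 0 \<and> (\<exists>m \<in> M. proj 1 (h [^] n) = proj 1 m)" using n(1) by blast
  qed
qed

text \<open>Positive powers of \<open>x\<close> and of \<open>inv x\<close> lie in
  \<open>insert \<one> P\<close>. If both were in \<open>P\<close>, matching powers of them would
  multiply to \<open>\<one>\<close> inside \<open>P\<close>; so one of them is trivial.\<close>

lemma trivial_power:
  assumes P: "P \<subseteq> carrier G" "\<one> \<notin> P" "\<And>u v. u \<in> P \<Longrightarrow> v \<in> P \<Longrightarrow> u \<otimes> v \<in> P"
    and alt: "B \<subseteq> series 0 \<or> (\<forall>g \<in> carrier G. \<forall>p \<in> P. g \<otimes> p \<otimes> inv g \<in> P)"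
    and Y: "Y = insert x ((set ws \<union> set vs) \<inter> insert \<one> P)"
    and ws: "set ws \<subseteq> insert \<one> P \<union> (\<lambda>g. g \<otimes> x \<otimes> inv g) ` carrier G"
      "set ws \<inter> (\<lambda>g. g \<otimes> x \<otimes> inv g) ` carrier G \<noteq> {}" "word_prod G ws = \<one>"
    and vs: "set vs \<subseteq> insert \<one> P \<union> (\<lambda>g. g \<otimes> inv x \<otimes> inv g) ` carrier G"
      "set vs \<inter> (\<lambda>g. g \<otimes> inv x \<otimes> inv g) ` carrier G \<noteq> {}" "word_prod G vs = \<one>"
  shows "\<exists>n::nat. n > 0 \<and> x [^] n = \<one>"
proof -
  let ?M = "insert \<one> P"
  have M: "?M \<subseteq> carrier G" "\<one> \<in> ?M" using P(1) by auto
  have M_mult: "u \<otimes> v \<in> ?M" if "u \<in> ?M" "v \<in> ?M" for u v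
    using that P by (auto simp: subset_iff)
  have alt': "B \<subseteq> series 0 \<or> (\<forall>g \<in> carrier G. \<forall>m \<in> ?M. g \<otimes> m \<otimes> inv g \<in> ?M)"
    using alt by auto
  have meet: "powers_meet ?M 1" by (rule powers_meet_1[OF M M_mult Y ws vs])
  have x: "x \<in> series 0" using Y tail_subset_series[of 0] tail_eq[of 0] by auto
  have xG: "x \<in> carrier G" by (rule subgroup.mem_carrier[OF series_subgroup x])
  obtain n :: nat where n: "n > 0" "x [^] n \<in> ?M"
    using powers_in_submonoid[OF M M_mult alt' meet x] by blast
  obtain m :: nat where m: "m > 0" "inv x [^] m \<in> ?M"
    using powers_in_submonoid[OF M M_mult alt' meet subgroup.m_inv_closed[OF series_subgroup x]] by blast
  \<comment> \<open>Only positive exponents are possible as \<open>\<one> \<notin> P\<close>; hence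
    \<open>m - 1\<close> and \<open>n - 1\<close> below.\<close>
  have pow: "p [^] Suc k \<in> P" if "p \<in> P" for p and k :: nat
    using that P by (induction k) auto
  show ?thesis
  proof (cases "x [^] n \<in> P \<and> inv x [^] m \<in> P")
    case True
    have "(x [^] n) [^] m \<in> P" "(inv x [^] m) [^] n \<in> P"
      using pow[of "x [^] n" "m - 1"] pow[of "inv x [^] m" "n - 1"] True n m by auto
    then have "(x [^] n) [^] m \<otimes> (inv x [^] m) [^] n \<in> P" by (rule P(3))
    then have "x [^] (n * m) \<otimes> inv (x [^] (n * m)) \<in> P"
      using xG by (simp add: nat_pow_pow nat_pow_inv mult.commute)
    then show ?thesis using P(2) xG by simp
  next
    case False
    then have "x [^] n = \<one> \<or> inv x [^] m = \<one>" using n m by auto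
    then show ?thesis using n m xG by (metis inv_eq_1_iff nat_pow_closed nat_pow_inv)
  qed
qed

end

section \<open>Maximal cones and orders\<close>

lemma iterated_commutators_subset_lower_central:
  assumes "B \<subseteq> carrier G" "Y \<subseteq> carrier G"
  shows "iterated_commutators G B Y n \<subseteq> lower_central G n"
proof (induction n)
  case 0 then show ?case using assms by simp
next
  case (Suc n)
  show ?case
  proof
    fix u assume "u \<in> iterated_commutators G B Y (Suc n)"
    then obtain y g where "y \<in> lower_central G n" "g \<in> carrier G"
      "u = y \<otimes>\<^bsub>G\<^esub> g \<otimes>\<^bsub>G\<^esub> inv\<^bsub>G\<^esub> y \<otimes>\<^bsub>G\<^esub> inv\<^bsub>G\<^esub> g"
      using Suc assms(1) by auto
    then show "u \<in> lower_central G (Suc n)" by (auto intro!: generate.incl)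
  qed
qed

text \<open>Iterated commutators do not change in a subgroup, so they vanish there at the same
  level.\<close>

lemma (in group) iterated_commutators_subgroup:
  assumes K: "subgroup K G" and "B \<subseteq> K" "Y \<subseteq> K"
  shows "iterated_commutators (G\<lparr>carrier := K\<rparr>) B Y n = iterated_commutators G B Y n
    \<and> iterated_commutators G B Y n \<subseteq> K"
proof (induction n)
  case 0 then show ?case using assms by simp
next
  case (Suc n)
  have "y \<otimes> g \<otimes> inv y \<otimes> inv g \<in> K" if "y \<in> K" "g \<in> K" for y g
    using that K by (simp add: subgroup.m_closed subgroup.m_inv_closed)
  then have "iterated_commutators G B Y (Suc n) \<subseteq> K"
    using Suc assms(2) by (auto simp: subset_iff)
  moreover have "iterated_commutators (G\<lparr>carrier := K\<rparr>) B Y (Suc n) = iterated_commutators G B Y (Suc n)"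
    using Suc assms(2) m_inv_consistent[OF K] by (auto simp: subset_iff)
  ultimately show ?case by blast
qed

lemma (in monoid) subsemigroup_gen_words:
  assumes "S \<subseteq> carrier G" "t \<in> subsemigroup_gen G S"
  shows "\<exists>ws. ws \<noteq> [] \<and> set ws \<subseteq> S \<and> word_prod G ws = t"
  using assms(2)
proof (induction rule: subsemigroup_gen.induct)
  case (incl s)
  then show ?case using assms(1) by (intro exI[of _ "[s]"]) auto
next
  case (mult x y)
  then obtain us vs where "us \<noteq> []" "set us \<subseteq> S" "word_prod G us = x" "set vs \<subseteq> S" "word_prod G vs = y"
    by blast
  then show ?case using assms(1) by (intro exI[of _ "us @ vs"]) (auto simp: word_prod_append)
qed

lemma (in monoid) word_prod_in_closed:
  assumes "P \<subseteq> carrier G" "\<And>u v. u \<in> P \<Longrightarrow> v \<in> P \<Longrightarrow> u \<otimes> v \<in> P" "set ws \<subseteq> P" "ws \<noteq> []"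
  shows "word_prod G ws \<in> P"
  using assms(4,3)
proof (induction ws rule: list_nonempty_induct)
  case (single w)
  then show ?case using assms(1) by auto
next
  case (cons w ws)
  then show ?case using assms(2) by simp
qed

text \<open>\<open>C\<close> is the set of allowed conjugators: \<open>{\<one>}\<close> for left-orders, the whole group for bi-orders.\<close>

definition (in group) conic :: "'a set \<Rightarrow> 'a set \<Rightarrow> bool"
  where "conic C P \<longleftrightarrow> P \<subseteq> carrier G \<and> \<one> \<notin> P \<and> (\<forall>u \<in> P. \<forall>v \<in> P. u \<otimes> v \<in> P) \<and>
    (\<forall>g \<in> C. \<forall>p \<in> P. g \<otimes> p \<otimes> inv g \<in> P)"

abbreviation (in group) conjugates :: "'a set \<Rightarrow> 'a \<Rightarrow> 'a set"
  where "conjugates C x \<equiv> (\<lambda>g. g \<otimes> x \<otimes> inv g) ` C"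

text \<open>Some letter must be a conjugate of \<open>y\<close>, since products of elements of
  \<open>P\<close> stay in \<open>P\<close> and avoid \<open>\<one>\<close>. One word needs only
  finitely many conjugators, and these can join a finite generating set.\<close>

lemma (in group) trivial_word_with_conjugators:
  assumes P: "conic C P" and C: "C \<subseteq> carrier G" and y: "y \<in> carrier G"
    and one: "\<one> \<in> subsemigroup_gen G (P \<union> conjugates C y)"
  shows "\<exists>ws E. finite E \<and> E \<subseteq> C \<and> set ws \<subseteq> P \<union> conjugates E y \<and>
    set ws \<inter> conjugates E y \<noteq> {} \<and> word_prod G ws = \<one>"
proof -
  have "P \<union> conjugates C y \<subseteq> carrier G" using P C y by (auto simp: conic_def)
  then obtain ws where ws: "ws \<noteq> []" "set ws \<subseteq> P \<union> conjugates C y" "word_prod G ws = \<one>"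
    using subsemigroup_gen_words one by blast
  obtain E where E: "E \<subseteq> C" "finite E" "set ws \<inter> conjugates C y = conjugates E y"
    using finite_subset_image[of "set ws \<inter> conjugates C y" "\<lambda>g. g \<otimes> y \<otimes> inv g" C] by auto
  have "\<not> set ws \<subseteq> P"
    using word_prod_in_closed[of P ws] P ws(1,3) by (auto simp: conic_def)
  then have "set ws \<inter> conjugates E y \<noteq> {}" using ws(2) E(3) by auto
  moreover have "set ws \<subseteq> P \<union> conjugates E y" using ws(2) E(3) by auto
  ultimately show ?thesis using ws(3) E(1,2) by (intro exI[of _ ws] exI[of _ E]) auto
qed

text \<open>Both obstructions are finite words, so \<open>trivial_power\<close> applies to
  \<open>P \<inter> K\<close> in the subgroup \<open>K\<close> generated by \<open>x\<close>, the
  letters from \<open>P\<close> and the conjugators.\<close>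

lemma (in group) torsion_if_both_signs_obstructed:
  assumes nil: "nilpotent_group G" and P: "conic C P" and C: "C = {\<one>} \<or> C = carrier G"
    and x: "x \<in> carrier G"
    and pos: "\<one> \<in> subsemigroup_gen G (P \<union> conjugates C x)"
    and neg: "\<one> \<in> subsemigroup_gen G (P \<union> conjugates C (inv x))"
  shows "\<exists>n::nat. n > 0 \<and> x [^] n = \<one>"
proof -
  have CG: "C \<subseteq> carrier G" using C by auto
  have PG: "P \<subseteq> carrier G" using P by (simp add: conic_def)
  obtain ws E where ws: "finite E" "E \<subseteq> C" "set ws \<subseteq> P \<union> conjugates E x"
    "set ws \<inter> conjugates E x \<noteq> {}" "word_prod G ws = \<one>"
    using trivial_word_with_conjugators[OF P CG x pos] by blast
  obtain vs F where vs: "finite F" "F \<subseteq> C" "set vs \<subseteq> P \<union> conjugates F (inv x)"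
    "set vs \<inter> conjugates F (inv x) \<noteq> {}" "word_prod G vs = \<one>"
    using trivial_word_with_conjugators[OF P CG inv_closed[OF x] neg] by blast
  define Y where "Y = insert x ((set ws \<union> set vs) \<inter> insert \<one> P)"
  define B where "B = Y \<union> E \<union> F"
  define K where "K = generate G B"
  let ?L = "G\<lparr>carrier := K\<rparr>"
  have BG: "B \<subseteq> carrier G" using ws vs CG PG x by (auto simp: B_def Y_def)
  have K: "subgroup K G" unfolding K_def by (rule generate_is_subgroup[OF BG])
  have BK: "B \<subseteq> K" unfolding K_def by (auto intro: generate.incl)
  then have YK: "Y \<subseteq> K" "x \<in> K" "E \<subseteq> K" "F \<subseteq> K" by (auto simp: B_def Y_def)
  have conjK: "g \<otimes> y \<otimes> inv g = g \<otimes>\<^bsub>?L\<^esub> y \<otimes>\<^bsub>?L\<^esub> inv\<^bsub>?L\<^esub> g" if "g \<in> K" for g y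
    using m_inv_consistent[OF K that] by simp
  have inv_x: "inv\<^bsub>?L\<^esub> x = inv x" using m_inv_consistent[OF K \<open>x \<in> K\<close>] .
  obtain c where c: "lower_central G c = {\<one>}" using nil unfolding nilpotent_group_def by blast
  interpret L: finitely_generated_nilpotent ?L B Y
  proof (rule finitely_generated_nilpotent.intro)
    show "group ?L" by (rule subgroup.subgroup_is_group[OF K is_group])
    show "finitely_generated_nilpotent_axioms ?L B Y"
    proof
      show "finite B" using ws vs by (simp add: B_def Y_def)
      show "B \<subseteq> carrier ?L" using BK by simp
      show "generate ?L B = carrier ?L"
        using generate_consistent[OF BK K] by (simp add: K_def)
      show "Y \<subseteq> B" unfolding B_def by blast
      have "iterated_commutators G B Y c \<subseteq> {\<one>}"
        using iterated_commutators_subset_lower_central[of B G Y c] BG c by (auto simp: B_def)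
      then show "\<exists>c. iterated_commutators ?L B Y c \<subseteq> {\<one>\<^bsub>?L\<^esub>}"
        using iterated_commutators_subgroup[OF K BK YK(1)] by auto
    qed
  qed
  have conj_sub: "conjugates D y \<subseteq> (\<lambda>g. g \<otimes>\<^bsub>?L\<^esub> y \<otimes>\<^bsub>?L\<^esub> inv\<^bsub>?L\<^esub> g) ` carrier ?L"
    if "D \<subseteq> K" for D y
    using that m_inv_consistent[OF K] by auto
  have setK: "set ws \<subseteq> K" "set vs \<subseteq> K"
  proof -
    have cover: "S \<subseteq> K" if "S \<subseteq> P \<union> D" "D \<subseteq> K" "S \<inter> P \<subseteq> K" for S D :: "'a set"
      using that by blast
    have closed: "conjugates D y \<subseteq> K" if "D \<subseteq> K" "y \<in> K" for D y
      using that K by (auto intro!: subgroup.m_closed subgroup.m_inv_closed)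
    have "inv x \<in> K" using K YK by (simp add: subgroup.m_inv_closed)
    then have "conjugates E x \<subseteq> K" "conjugates F (inv x) \<subseteq> K"
      using closed YK by simp_all
    moreover have "set ws \<inter> P \<subseteq> K" "set vs \<inter> P \<subseteq> K" using YK(1) unfolding Y_def by auto
    ultimately show "set ws \<subseteq> K" "set vs \<subseteq> K"
      using cover[OF ws(3)] cover[OF vs(3)] by simp_all
  qed
  have "\<exists>n::nat. n > 0 \<and> x [^]\<^bsub>?L\<^esub> n = \<one>\<^bsub>?L\<^esub>"
  proof (rule L.trivial_power[of "P \<inter> K" x ws vs])
    show "P \<inter> K \<subseteq> carrier ?L" by simp
    show "\<one>\<^bsub>?L\<^esub> \<notin> P \<inter> K" using P by (simp add: conic_def)
    show "u \<otimes>\<^bsub>?L\<^esub> v \<in> P \<inter> K" if "u \<in> P \<inter> K" "v \<in> P \<inter> K" for u v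
      using that P K by (auto simp: conic_def intro: subgroup.m_closed)
    show "B \<subseteq> L.series 0 \<or> (\<forall>g \<in> carrier ?L. \<forall>p \<in> P \<inter> K. g \<otimes>\<^bsub>?L\<^esub> p \<otimes>\<^bsub>?L\<^esub> inv\<^bsub>?L\<^esub> g \<in> P \<inter> K)"
      using C
    proof
      \<comment> \<open>With trivial conjugators, \<open>B\<close> adds at most
        \<open>\<one>\<close> to \<open>Y\<close>, so \<open>series 0\<close> is the whole
        subgroup.\<close>
      assume "C = {\<one>}"
      then have "B \<subseteq> insert \<one> Y" using ws(2) vs(2) by (auto simp: B_def)
      also have "\<dots> \<subseteq> L.series 0"
        using L.tail_subset_series[of 0] L.tail_eq[of 0] subgroup.one_closed[OF L.series_subgroup[of 0]] by auto
      finally show ?thesis ..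
    next
      assume C: "C = carrier G"
      have "g \<otimes> p \<otimes> inv g \<in> P \<inter> K" if "g \<in> K" "p \<in> P \<inter> K" for g p
        using that P C K subgroup.mem_carrier[OF K]
        by (auto simp: conic_def intro!: subgroup.m_closed subgroup.m_inv_closed)
      then show ?thesis using conjK by auto
    qed
    show "Y = insert x ((set ws \<union> set vs) \<inter> insert \<one>\<^bsub>?L\<^esub> (P \<inter> K))"
      using setK by (auto simp: Y_def)
    show "set ws \<subseteq> insert \<one>\<^bsub>?L\<^esub> (P \<inter> K) \<union> (\<lambda>g. g \<otimes>\<^bsub>?L\<^esub> x \<otimes>\<^bsub>?L\<^esub> inv\<^bsub>?L\<^esub> g) ` carrier ?L"
      using ws(3) setK conj_sub[OF YK(3), of x] by blast
    show "set ws \<inter> (\<lambda>g. g \<otimes>\<^bsub>?L\<^esub> x \<otimes>\<^bsub>?L\<^esub> inv\<^bsub>?L\<^esub> g) ` carrier ?L \<noteq> {}"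
      using ws(4) conj_sub[OF YK(3), of x] by blast
    show "set vs \<subseteq> insert \<one>\<^bsub>?L\<^esub> (P \<inter> K) \<union> (\<lambda>g. g \<otimes>\<^bsub>?L\<^esub> inv\<^bsub>?L\<^esub> x \<otimes>\<^bsub>?L\<^esub> inv\<^bsub>?L\<^esub> g) ` carrier ?L"
      unfolding inv_x using vs(3) setK conj_sub[OF YK(4), of "inv x"] by blast
    show "set vs \<inter> (\<lambda>g. g \<otimes>\<^bsub>?L\<^esub> inv\<^bsub>?L\<^esub> x \<otimes>\<^bsub>?L\<^esub> inv\<^bsub>?L\<^esub> g) ` carrier ?L \<noteq> {}"
      unfolding inv_x using vs(4) conj_sub[OF YK(4), of "inv x"] by blast
    show "word_prod ?L ws = \<one>\<^bsub>?L\<^esub>" "word_prod ?L vs = \<one>\<^bsub>?L\<^esub>"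
      using ws(5) vs(5) by (simp_all add: word_prod_def)
  qed
  then show ?thesis using nat_pow_consistent[of x _ K] by simp
qed

text \<open>As \<open>C\<close> is a subgroup, conjugation by its elements maps the conjugates of
  \<open>x\<close> to one another, and it distributes over products.\<close>

lemma (in group) conic_adjoin:
  assumes P: "conic C P" and C: "subgroup C G" and x: "x \<in> carrier G"
    and one: "\<one> \<notin> subsemigroup_gen G (P \<union> conjugates C x)"
  shows "conic C (subsemigroup_gen G (P \<union> conjugates C x))"
proof -
  let ?S = "P \<union> conjugates C x"
  have CG: "C \<subseteq> carrier G" using C by (rule subgroup.subset)
  have SG: "?S \<subseteq> carrier G" using P CG x by (auto simp: conic_def)
  have closed: "t \<in> carrier G" if "t \<in> subsemigroup_gen G ?S" for t
    using that SG by (induction rule: subsemigroup_gen.induct) auto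
  have conj: "g \<otimes> t \<otimes> inv g \<in> subsemigroup_gen G ?S" if "t \<in> subsemigroup_gen G ?S" and g: "g \<in> C" for g t
    using that(1)
  proof (induction rule: subsemigroup_gen.induct)
    case (incl s)
    have gG: "g \<in> carrier G" using g CG by blast
    have "g \<otimes> s \<otimes> inv g \<in> ?S"
      using incl
    proof
      assume "s \<in> P" then show ?thesis using P g by (simp add: conic_def)
    next
      assume "s \<in> conjugates C x"
      then obtain k where k: "k \<in> C" "s = k \<otimes> x \<otimes> inv k" by blast
      then have "k \<in> carrier G" using CG by blast
      then have "g \<otimes> s \<otimes> inv g = (g \<otimes> k) \<otimes> x \<otimes> inv (g \<otimes> k)"
        using gG x k(2) by (simp add: m_assoc inv_mult_group)
      then show ?thesis using subgroup.m_closed[OF C g k(1)] by blast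
    qed
    then show ?case by (rule subsemigroup_gen.incl)
  next
    case (mult u v)
    have "g \<in> carrier G" "u \<in> carrier G" "v \<in> carrier G" using g CG mult closed by auto
    then have "g \<otimes> (u \<otimes> v) \<otimes> inv g = (g \<otimes> u \<otimes> inv g) \<otimes> (g \<otimes> v \<otimes> inv g)"
      by (simp add: m_assoc flip: m_assoc[of "inv g" g])
    then show ?case using subsemigroup_gen.mult[OF mult.IH] by (simp only:)
  qed
  show ?thesis
    unfolding conic_def
  proof (intro conjI ballI subsetI)
    show "t \<in> carrier G" if "t \<in> subsemigroup_gen G ?S" for t using that by (rule closed)
    show "\<one> \<notin> subsemigroup_gen G ?S" by (rule one)
    show "u \<otimes> v \<in> subsemigroup_gen G ?S"
      if "u \<in> subsemigroup_gen G ?S" "v \<in> subsemigroup_gen G ?S" for u v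
      using that by (rule subsemigroup_gen.mult)
    show "g \<otimes> t \<otimes> inv g \<in> subsemigroup_gen G ?S"
      if "g \<in> C" "t \<in> subsemigroup_gen G ?S" for g t
      using that(2,1) by (rule conj)
  qed
qed

text \<open>A maximal cone contains \<open>x\<close> unless adjoining its conjugates produces
  \<open>\<one>\<close>. If both \<open>x\<close> and \<open>inv x\<close> were missing, both would
  be obstructed, and \<open>x\<close> would be a torsion element.\<close>

lemma (in group) maximal_conic:
  assumes nil: "nilpotent_group G" and tf: "torsion_free G"
    and C: "C = {\<one>} \<or> C = carrier G" and P0: "conic C P0"
  shows "\<exists>P. conic C P \<and> P0 \<subseteq> P \<and> (\<forall>x \<in> carrier G. x = \<one> \<or> x \<in> P \<or> inv x \<in> P)"
proof -
  let ?A = "{P. conic C P \<and> P0 \<subseteq> P}"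
  have "\<exists>P \<in> ?A. \<forall>Q \<in> ?A. P \<subseteq> Q \<longrightarrow> Q = P"
  proof (rule subset_Zorn_nonempty)
    show "?A \<noteq> {}" using P0 by blast
    fix \<C> assume ne: "\<C> \<noteq> {}" and chain: "subset.chain ?A \<C>"
    have sub: "\<And>P. P \<in> \<C> \<Longrightarrow> conic C P \<and> P0 \<subseteq> P"
      and tot: "\<And>P Q. P \<in> \<C> \<Longrightarrow> Q \<in> \<C> \<Longrightarrow> P \<subseteq> Q \<or> Q \<subseteq> P"
      using chain unfolding subset_chain_def by blast+
    have "u \<otimes> v \<in> \<Union> \<C>" if uv: "u \<in> \<Union> \<C>" "v \<in> \<Union> \<C>" for u v
    proof -
      obtain P Q where "P \<in> \<C>" "u \<in> P" "Q \<in> \<C>" "v \<in> Q" using uv by blast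
      then obtain R where "R \<in> \<C>" "u \<in> R" "v \<in> R" using tot[of P Q] by blast
      then show ?thesis using sub[of R] unfolding conic_def by blast
    qed
    moreover have "g \<otimes> p \<otimes> inv g \<in> \<Union> \<C>" if "g \<in> C" "p \<in> \<Union> \<C>" for g p
      using that sub unfolding conic_def by blast
    moreover have "\<Union> \<C> \<subseteq> carrier G" "\<one> \<notin> \<Union> \<C>" using sub unfolding conic_def by blast+
    ultimately have "conic C (\<Union> \<C>)" unfolding conic_def by blast
    moreover have "P0 \<subseteq> \<Union> \<C>" using ne sub by blast
    ultimately show "\<Union> \<C> \<in> ?A" by blast
  qed
  then obtain P where P: "conic C P" "P0 \<subseteq> P" and max: "\<And>Q. conic C Q \<Longrightarrow> P \<subseteq> Q \<Longrightarrow> Q = P"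
    by (auto dest: order_trans)
  have Csub: "subgroup C G" using C triv_subgroup subgroup_self by blast
  have mem: "x \<in> P" if x: "x \<in> carrier G" and one: "\<one> \<notin> subsemigroup_gen G (P \<union> conjugates C x)" for x
  proof -
    have "P \<subseteq> subsemigroup_gen G (P \<union> conjugates C x)" by (auto intro: subsemigroup_gen.incl)
    then have "subsemigroup_gen G (P \<union> conjugates C x) = P"
      by (rule max[OF conic_adjoin[OF P(1) Csub x one]])
    moreover have "\<one> \<otimes> x \<otimes> inv \<one> \<in> conjugates C x"
      using subgroup.one_closed[OF Csub] by blast
    ultimately show ?thesis using x subsemigroup_gen.incl[of x "P \<union> conjugates C x" G] by auto
  qed
  have "x = \<one> \<or> x \<in> P \<or> inv x \<in> P" if x: "x \<in> carrier G" for x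
  proof (rule ccontr)
    assume "\<not> (x = \<one> \<or> x \<in> P \<or> inv x \<in> P)"
    then have "\<exists>n::nat. n > 0 \<and> x [^] n = \<one>"
      using torsion_if_both_signs_obstructed[OF nil P(1) C x] mem[OF x] mem[OF inv_closed[OF x]] by blast
    then show False using tf x \<open>\<not> _\<close> unfolding torsion_free_def by blast
  qed
  then show ?thesis using P by blast
qed

section \<open>Translation between cones and orders\<close>

definition cone_order :: "('a, 'b) monoid_scheme \<Rightarrow> 'a set \<Rightarrow> 'a rel"
  where "cone_order G P = {(a, b). a \<in> carrier G \<and> b \<in> carrier G \<and> (a = b \<or> inv\<^bsub>G\<^esub> a \<otimes>\<^bsub>G\<^esub> b \<in> P)}"

lemma (in group) linear_order_cone_order:
  assumes P: "conic C P" and total: "\<And>x. x \<in> carrier G \<Longrightarrow> x = \<one> \<or> x \<in> P \<or> inv x \<in> P"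
  shows "linear_order_on (carrier G) (cone_order G P)"
proof -
  have mult: "inv a \<otimes> c \<in> P" if "inv a \<otimes> b \<in> P" "inv b \<otimes> c \<in> P" "a \<in> carrier G" "b \<in> carrier G" "c \<in> carrier G" for a b c
  proof -
    have "(inv a \<otimes> b) \<otimes> (inv b \<otimes> c) = inv a \<otimes> c"
      using that by (simp add: m_assoc flip: m_assoc[of b "inv b"])
    then show ?thesis using that P unfolding conic_def by metis
  qed
  have "refl_on (carrier G) (cone_order G P)" by (auto simp: refl_on_def cone_order_def)
  moreover have "cone_order G P \<subseteq> carrier G \<times> carrier G" by (auto simp: cone_order_def)
  moreover have "trans (cone_order G P)"
    using mult by (auto simp: trans_def cone_order_def)
  moreover have "antisym (cone_order G P)"
  proof (rule antisymI)
    fix a b assume "(a, b) \<in> cone_order G P" "(b, a) \<in> cone_order G P"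
    then show "a = b" using mult[of a b a] P by (auto simp: cone_order_def conic_def)
  qed
  moreover have "total_on (carrier G) (cone_order G P)"
  proof (rule total_onI)
    fix a b assume ab: "a \<in> carrier G" "b \<in> carrier G" "a \<noteq> b"
    have "inv a \<otimes> b \<noteq> \<one>" using ab by (metis inv_equality inv_inv inv_closed)
    moreover have "inv (inv a \<otimes> b) = inv b \<otimes> a" using ab by (simp add: inv_mult_group)
    ultimately show "(a, b) \<in> cone_order G P \<or> (b, a) \<in> cone_order G P"
      using total[of "inv a \<otimes> b"] ab by (auto simp: cone_order_def)
  qed
  ultimately show ?thesis by (simp add: linear_order_on_def partial_order_on_def preorder_on_def)
qed

lemma (in group) positive_cone_cone_order:
  assumes "conic C P"
  shows "positive_cone G (cone_order G P) = P"
  using assms by (auto simp: positive_cone_def cone_order_def conic_def)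

text \<open>Left factors cancel in \<open>inv a \<otimes> b\<close>, which is why
  \<open>cone_order\<close> uses this quotient rather than \<open>b \<otimes> inv a\<close>.\<close>

lemma (in group) left_order_cone_order:
  assumes "linear_order_on (carrier G) (cone_order G P)"
  shows "left_order G (cone_order G P)"
proof -
  have "inv (c \<otimes> a) \<otimes> (c \<otimes> b) = inv a \<otimes> b" if "a \<in> carrier G" "b \<in> carrier G" "c \<in> carrier G" for a b c
    using that by (simp add: inv_mult_group m_assoc flip: m_assoc[of "inv c" c])
  then show ?thesis using assms by (auto simp: left_order_def cone_order_def)
qed

text \<open>A right factor \<open>d\<close> conjugates the quotient \<open>inv a \<otimes> b\<close>
  by \<open>inv d\<close>, so closure of \<open>P\<close> under conjugation gives right
  invariance.\<close>

lemma (in group) bi_order_cone_order: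
  assumes "linear_order_on (carrier G) (cone_order G P)" and P: "conic (carrier G) P"
  shows "bi_order G (cone_order G P)"
proof -
  have "inv (c \<otimes> a \<otimes> d) \<otimes> (c \<otimes> b \<otimes> d) \<in> P"
    if "inv a \<otimes> b \<in> P" "a \<in> carrier G" "b \<in> carrier G" "c \<in> carrier G" "d \<in> carrier G" for a b c d
  proof -
    have "inv (c \<otimes> a \<otimes> d) \<otimes> (c \<otimes> b \<otimes> d) = inv d \<otimes> (inv a \<otimes> b) \<otimes> inv (inv d)"
      using that by (simp add: inv_mult_group m_assoc flip: m_assoc[of "inv c" c])
    then show ?thesis using that P inv_closed[of d] unfolding conic_def by metis
  qed
  then show ?thesis using assms(1) by (auto simp: bi_order_def cone_order_def)
qed

text \<open>Translating the positivity of \<open>v\<close> by \<open>u\<close> places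
  \<open>u \<otimes> v\<close> above \<open>u\<close>, hence above \<open>\<one>\<close>; equality
  with \<open>\<one>\<close> would force \<open>u = \<one>\<close> by antisymmetry.\<close>

lemma (in group) left_order_positive_cone_mult:
  assumes r: "left_order G r" and "u \<in> positive_cone G r" "v \<in> positive_cone G r"
  shows "u \<otimes> v \<in> positive_cone G r"
proof -
  have uv: "u \<in> carrier G" "v \<in> carrier G" "(\<one>, u) \<in> r" "(\<one>, v) \<in> r" "u \<noteq> \<one>"
    using assms by (auto simp: positive_cone_def)
  have inv: "(u \<otimes> \<one>, u \<otimes> v) \<in> r" using r uv one_closed unfolding left_order_def by blast
  have tr: "trans r" "antisym r"
    using r by (auto simp: left_order_def linear_order_on_def partial_order_on_def preorder_on_def)
  have "(\<one>, u \<otimes> v) \<in> r" using inv uv tr(1) unfolding trans_def by (metis r_one)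
  moreover have "u \<otimes> v \<noteq> \<one>" using inv uv tr(2) by (auto dest: antisymD)
  ultimately show ?thesis using uv by (simp add: positive_cone_def)
qed

lemma (in group) bi_order_imp_left_order: "bi_order G r \<Longrightarrow> left_order G r"
  unfolding bi_order_def left_order_def by (metis m_closed one_closed r_one)

lemma (in group) bi_order_positive_cone_conj:
  assumes r: "bi_order G r" and u: "u \<in> positive_cone G r" and g: "g \<in> carrier G"
  shows "g \<otimes> u \<otimes> inv g \<in> positive_cone G r"
proof -
  have u': "u \<in> carrier G" "(\<one>, u) \<in> r" "u \<noteq> \<one>" using u by (auto simp: positive_cone_def)
  then have "(g \<otimes> \<one> \<otimes> inv g, g \<otimes> u \<otimes> inv g) \<in> r"
    using r g unfolding bi_order_def by (metis inv_closed one_closed)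
  moreover have "g \<otimes> u \<otimes> inv g \<noteq> \<one>"
  proof
    assume "g \<otimes> u \<otimes> inv g = \<one>"
    moreover have "(g \<otimes> u \<otimes> inv g) \<otimes> g = g \<otimes> u" using u' g by (simp add: m_assoc)
    ultimately have "g \<otimes> u = g \<otimes> \<one>" using g by simp
    then show False using u' g by simp
  qed
  ultimately show ?thesis using u' g by (simp add: positive_cone_def)
qed

theorem corollary5:
  fixes G :: "('a, 'b) monoid_scheme"
  assumes "nilpotent_group G" and "torsion_free G"
  shows "(complementary_problems G (identity_problem G) (left_order_extension_problem G) \<and>
          (\<forall>S. finite S \<and> S \<subseteq> carrier G \<longrightarrow>
            (extends_to_left_order G S \<longleftrightarrow> \<one>\<^bsub>G\<^esub> \<notin> subsemigroup_gen G S))) \<and>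
         (complementary_problems G (normal_identity_problem G) (bi_order_extension_problem G) \<and>
          (\<forall>S. finite S \<and> S \<subseteq> carrier G \<longrightarrow>
            (extends_to_bi_order G S \<longleftrightarrow> \<one>\<^bsub>G\<^esub> \<notin> normal_subsemigroup_gen G S)))"
proof -
  interpret group G using assms(1) by (simp add: nilpotent_group_def)
  have left: "extends_to_left_order G S \<longleftrightarrow> \<one>\<^bsub>G\<^esub> \<notin> subsemigroup_gen G S" if S: "S \<subseteq> carrier G" for S
  proof
    assume "extends_to_left_order G S"
    then obtain r where r: "left_order G r" "S \<subseteq> positive_cone G r"
      unfolding extends_to_left_order_def by blast
    \<comment> \<open>The positive cone is a subsemigroup that misses the identity.\<close>
    have "t \<in> positive_cone G r" if "t \<in> subsemigroup_gen G S" for t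
      using that r left_order_positive_cone_mult
      by (induction rule: subsemigroup_gen.induct) auto
    then show "\<one>\<^bsub>G\<^esub> \<notin> subsemigroup_gen G S" by (auto simp: positive_cone_def)
  next
    assume one: "\<one>\<^bsub>G\<^esub> \<notin> subsemigroup_gen G S"
    have closed: "t \<in> carrier G" if "t \<in> subsemigroup_gen G S" for t
      using that S by (induction rule: subsemigroup_gen.induct) auto
    \<comment> \<open>The generated subsemigroup is itself the starting cone; the only conjugator is
      the identity.\<close>
    have "conic {\<one>\<^bsub>G\<^esub>} (subsemigroup_gen G S)"
      using one closed subsemigroup_gen.mult by (auto simp: conic_def)
    then obtain P where P: "conic {\<one>\<^bsub>G\<^esub>} P" "subsemigroup_gen G S \<subseteq> P"
      "\<forall>x \<in> carrier G. x = \<one>\<^bsub>G\<^esub> \<or> x \<in> P \<or> inv\<^bsub>G\<^esub> x \<in> P"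
      using maximal_conic[OF assms, of "{\<one>\<^bsub>G\<^esub>}"] by blast
    then have "left_order G (cone_order G P)"
      using linear_order_cone_order left_order_cone_order by blast
    moreover have "S \<subseteq> positive_cone G (cone_order G P)"
      using P subsemigroup_gen.incl[of _ S G] unfolding positive_cone_cone_order[OF P(1)] by blast
    ultimately show "extends_to_left_order G S" unfolding extends_to_left_order_def by blast
  qed
  have bi: "extends_to_bi_order G S \<longleftrightarrow> \<one>\<^bsub>G\<^esub> \<notin> normal_subsemigroup_gen G S" if S: "S \<subseteq> carrier G" for S
  proof
    assume "extends_to_bi_order G S"
    then obtain r where r: "bi_order G r" "S \<subseteq> positive_cone G r"
      unfolding extends_to_bi_order_def by blast
    have "t \<in> positive_cone G r" if "t \<in> normal_subsemigroup_gen G S" for t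
      using that r bi_order_positive_cone_conj left_order_positive_cone_mult[OF bi_order_imp_left_order]
      by (induction rule: normal_subsemigroup_gen.induct) auto
    then show "\<one>\<^bsub>G\<^esub> \<notin> normal_subsemigroup_gen G S" by (auto simp: positive_cone_def)
  next
    assume one: "\<one>\<^bsub>G\<^esub> \<notin> normal_subsemigroup_gen G S"
    have closed: "t \<in> carrier G" if "t \<in> normal_subsemigroup_gen G S" for t
      using that S by (induction rule: normal_subsemigroup_gen.induct) auto
    have "conic (carrier G) (normal_subsemigroup_gen G S)"
      using one closed normal_subsemigroup_gen.mult normal_subsemigroup_gen.conj by (auto simp: conic_def)
    then obtain P where P: "conic (carrier G) P" "normal_subsemigroup_gen G S \<subseteq> P"
      "\<forall>x \<in> carrier G. x = \<one>\<^bsub>G\<^esub> \<or> x \<in> P \<or> inv\<^bsub>G\<^esub> x \<in> P"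
      using maximal_conic[OF assms, of "carrier G"] by blast
    then have "bi_order G (cone_order G P)"
      using linear_order_cone_order bi_order_cone_order by blast
    moreover have "S \<subseteq> positive_cone G (cone_order G P)"
      using P normal_subsemigroup_gen.incl[of _ S G] unfolding positive_cone_cone_order[OF P(1)] by blast
    ultimately show "extends_to_bi_order G S" unfolding extends_to_bi_order_def by blast
  qed
  show ?thesis
    unfolding complementary_problems_def identity_problem_def left_order_extension_problem_def
      normal_identity_problem_def bi_order_extension_problem_def instances_def
    using left bi by auto
qed

end
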